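(* Let $\Gamma$ be the metric graph that is a triangle (a cycle with three vertices and three edges) with edge lengths $3,4,5$, and let $\widetilde{\Gamma}$ be the equilateral bipartite metric graph with edge length $1$ obtained by adding vertices on each edge of $\Gamma$ (a cycle with $12$ vertices and $12$ edges of length $1$). Then for all $k\in\mathbb{N}$: $$\lambda_k(L^{st}(\widetilde{\Gamma}))=\lambda_k(L^{a/st}(\widetilde{\Gamma})),\qquad \lambda_k(L^{a/st}(\Gamma))\leq\lambda_{k+1}(L^{a/st}(\widetilde{\Gamma})),\qquad \lambda_{k+1}(L^{st}(\Gamma))\geq\lambda_k(L^{a/st}(\Gamma)).$$
   Context: A metric graph $\Gamma$ consists of a finite vertex set and a finite edge set $\{e_1,\dots,e_N\}$; it is connected and simple, and each edge $e_i$ has a length $l_{e_i}\in(0,\infty)$ and is identified with the interval $[0,l_{e_i}]$ (the endpoints $0$ and $l_{e_i}$ corresponding to the two vertices of $e_i$). It is equilateral if all edges have the same length, and bipartite if the vertex set is the disjoint union of two sets such that every edge has one endpoint in each. $L^2(\Gamma)=\bigoplus_i L^2[0,l_{e_i}]$, and $f_i$ denotes the restriction of $f$ to $e_i$. The maximal domain consists of all $f\in L^2(\Gamma)$ with $f_i,f_i'$ absolutely continuous on $[0,l_{e_i}]$ for every $i$ and $-f''\in L^2(\Gamma)$. Both operators below act by $f\mapsto -f''$ on each edge. The standard Laplace operator $L^{st}(\Gamma)$ has as domain the functions $f$ in the maximal domain such that at every vertex $v$ the values at $v$ of $f$ along all incident edges coincide, and the sum over incident edges of the derivatives of $f$ at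 $v$, taken in the direction outgoing from $v$, is $0$. The anti-standard Laplace operator $L^{a/st}(\Gamma)$ has as domain the functions $f$ in the maximal domain such that at every vertex $v$ the derivatives at $v$ along all incident edges, taken in the outgoing direction, coincide, and the sum over incident edges of the values of $f$ at $v$ is $0$. The spectra consist of isolated nonnegative eigenvalues of finite multiplicity; $\lambda_1(\cdot)\leq\lambda_2(\cdot)\leq\cdots$ denotes the eigenvalues in nondecreasing order counted with multiplicity, and $\mathbb{N}=\{1,2,3,\dots\}$. *)

theory Defs
  imports "HOL-Analysis.Analysis" "HOL-Library.Function_Algebras"
begin

section \<open>Metric graphs\<close>

text \<open>
  An edge \<open>e\<close> is identified with \<open>{0..len G e}\<close>, where \<open>0\<close> corresponds to the vertex
  \<open>tail G e\<close> and \<open>len G e\<close> to the vertex \<open>head G e\<close>. The orientation is only a choice of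
  coordinate; the graph itself is undirected.
\<close>

record ('v, 'e) mgraph =
  verts :: "'v set"
  edges :: "'e set"
  tail  :: "'e \<Rightarrow> 'v"
  head  :: "'e \<Rightarrow> 'v"
  len   :: "'e \<Rightarrow> real"

definition ends :: "('v, 'e) mgraph \<Rightarrow> 'e \<Rightarrow> 'v set" where
  "ends G e = {tail G e, head G e}"

definition adjacent :: "('v, 'e) mgraph \<Rightarrow> ('v \<times> 'v) set" where
  "adjacent G = {(u, v). \<exists>e\<in>edges G. ends G e = {u, v}}"

locale metric_graph =
  fixes G :: "('v, 'e) mgraph"
  assumes finite_verts: "finite (verts G)"
    and finite_edges: "finite (edges G)"
    and nonempty: "verts G \<noteq> {}"
    and ends_in_verts: "\<And>e. e \<in> edges G \<Longrightarrow> ends G e \<subseteq> verts G"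
    and no_loops: "\<And>e. e \<in> edges G \<Longrightarrow> tail G e \<noteq> head G e"
    and no_parallel_edges: "inj_on (ends G) (edges G)"
    and connected: "\<And>u v. u \<in> verts G \<Longrightarrow> v \<in> verts G \<Longrightarrow> (u, v) \<in> (adjacent G)\<^sup>*"
    and len_pos: "\<And>e. e \<in> edges G \<Longrightarrow> 0 < len G e"

definition equilateral :: "('v, 'e) mgraph \<Rightarrow> bool" where
  "equilateral G \<longleftrightarrow> (\<forall>e\<in>edges G. \<forall>e'\<in>edges G. len G e = len G e')"

definition bipartite :: "('v, 'e) mgraph \<Rightarrow> bool" where
  "bipartite G \<longleftrightarrow> (\<exists>A B. A \<inter> B = {} \<and> A \<union> B = verts G \<and>
     (\<forall>e\<in>edges G. \<exists>a\<in>A. \<exists>b\<in>B. ends G e = {a, b}))"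

definition incident :: "('v, 'e) mgraph \<Rightarrow> 'v \<Rightarrow> 'e set" where
  "incident G v = {e \<in> edges G. v \<in> ends G e}"

text \<open>
  Adding vertices: edge \<open>e\<close> is cut into \<open>m e\<close> pieces of equal length. The piece \<open>(e, j)\<close> is
  the part of \<open>e\<close> between the points at \<open>j / m e\<close> and \<open>(j + 1) / m e\<close> of its length; an
  interior division point is the new vertex \<open>Inr (e, j)\<close>, and \<open>Inl v\<close> is the old vertex \<open>v\<close>.
\<close>

definition division_point ::
  "('v, 'e) mgraph \<Rightarrow> ('e \<Rightarrow> nat) \<Rightarrow> 'e \<Rightarrow> nat \<Rightarrow> 'v + 'e \<times> nat" where
  "division_point G m e j =
     (if j = 0 then Inl (tail G e) else if j = m e then Inl (head G e) else Inr (e, j))"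

definition subdivide ::
  "('v, 'e) mgraph \<Rightarrow> ('e \<Rightarrow> nat) \<Rightarrow> ('v + 'e \<times> nat, 'e \<times> nat) mgraph" where
  "subdivide G m = \<lparr>
     verts = Inl ` verts G \<union> Inr ` (SIGMA e:edges G. {0<..<m e}),
     edges = (SIGMA e:edges G. {..<m e}),
     tail = (\<lambda>(e, j). division_point G m e j),
     head = (\<lambda>(e, j). division_point G m e (Suc j)),
     len = (\<lambda>(e, j). len G e / real (m e))\<rparr>"

definition triangle345 :: "(nat, nat) mgraph" where
  "triangle345 = \<lparr>
     verts = {0, 1, 2},
     edges = {0, 1, 2},
     tail = (\<lambda>i. i),
     head = (\<lambda>i. (i + 1) mod 3),
     len = (\<lambda>i. [3, 4, 5] ! i)\<rparr>"

definition unit_triangle345 :: "(nat + nat \<times> nat, nat \<times> nat) mgraph" where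
  "unit_triangle345 = subdivide triangle345 (\<lambda>i. [3, 4, 5] ! i)"


section \<open>Functions on a metric graph\<close>

text \<open>
  A function is given by its restrictions to the edges. A class in the maximal domain has a
  unique representative that is continuous on every edge; it is extended by \<open>0\<close> outside the
  edges, so that distinct functions \<open>f\<close> below represent distinct elements of \<open>L\<^sup>2\<close>.
\<close>

type_synonym 'e gfun = "'e \<Rightarrow> real \<Rightarrow> complex"

definition cscale :: "complex \<Rightarrow> 'e gfun \<Rightarrow> 'e gfun" where
  "cscale c f = (\<lambda>e x. c * f e x)"

global_interpretation gfun: vector_space "cscale :: complex \<Rightarrow> 'e gfun \<Rightarrow> 'e gfun"
  by unfold_locales (auto simp: cscale_def fun_eq_iff algebra_simps)

definition abs_continuous_on_interval :: "real \<Rightarrow> real \<Rightarrow> (real \<Rightarrow> complex) \<Rightarrow> bool" where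
  "abs_continuous_on_interval a b f \<longleftrightarrow>
     (\<forall>\<epsilon>>0. \<exists>\<delta>>0. \<forall>(n::nat) x y.
        (\<forall>i<n. a \<le> x i \<and> x i \<le> y i \<and> y i \<le> b) \<longrightarrow>
        disjoint_family_on (\<lambda>i. {x i<..<y i}) {..<n} \<longrightarrow>
        (\<Sum>i<n. y i - x i) < \<delta> \<longrightarrow>
        (\<Sum>i<n. norm (f (y i) - f (x i))) < \<epsilon>)"

definition square_integrable_on_interval :: "real \<Rightarrow> real \<Rightarrow> (real \<Rightarrow> complex) \<Rightarrow> bool" where
  "square_integrable_on_interval a b f \<longleftrightarrow>
     f \<in> borel_measurable (lebesgue_on {a..b}) \<and>
     integrable (lebesgue_on {a..b}) (\<lambda>x. (norm (f x))\<^sup>2)"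

text \<open>One-sided at the two endpoints, and arbitrary where the derivative does not exist.\<close>

definition deriv_on :: "real \<Rightarrow> (real \<Rightarrow> complex) \<Rightarrow> real \<Rightarrow> complex" where
  "deriv_on l \<phi> x = vector_derivative \<phi> (at x within {0..l})"

definition max_dom :: "('v, 'e) mgraph \<Rightarrow> 'e gfun set" where
  "max_dom G = {f.
     (\<forall>e x. e \<notin> edges G \<or> x \<notin> {0..len G e} \<longrightarrow> f e x = 0) \<and>
     (\<forall>e\<in>edges G.
        square_integrable_on_interval 0 (len G e) (f e) \<and>
        abs_continuous_on_interval 0 (len G e) (f e) \<and>
        (\<forall>x\<in>{0..len G e}. f e differentiable (at x within {0..len G e})) \<and>
        abs_continuous_on_interval 0 (len G e) (deriv_on (len G e) (f e)) \<and>
        square_integrable_on_interval 0 (len G e)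
          (deriv_on (len G e) (deriv_on (len G e) (f e))))}"

text \<open>Value and outgoing derivative at the vertex \<open>v\<close> along an incident edge \<open>e\<close>.\<close>

definition vertex_value :: "('v, 'e) mgraph \<Rightarrow> 'e gfun \<Rightarrow> 'v \<Rightarrow> 'e \<Rightarrow> complex" where
  "vertex_value G f v e = (if v = tail G e then f e 0 else f e (len G e))"

definition outgoing_deriv :: "('v, 'e) mgraph \<Rightarrow> 'e gfun \<Rightarrow> 'v \<Rightarrow> 'e \<Rightarrow> complex" where
  "outgoing_deriv G f v e =
     (if v = tail G e then deriv_on (len G e) (f e) 0
      else - deriv_on (len G e) (f e) (len G e))"

definition dom_st :: "('v, 'e) mgraph \<Rightarrow> 'e gfun set" where
  "dom_st G = {f \<in> max_dom G. \<forall>v\<in>verts G.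
     (\<forall>e\<in>incident G v. \<forall>e'\<in>incident G v. vertex_value G f v e = vertex_value G f v e') \<and>
     (\<Sum>e\<in>incident G v. outgoing_deriv G f v e) = 0}"

definition dom_ast :: "('v, 'e) mgraph \<Rightarrow> 'e gfun set" where
  "dom_ast G = {f \<in> max_dom G. \<forall>v\<in>verts G.
     (\<forall>e\<in>incident G v. \<forall>e'\<in>incident G v. outgoing_deriv G f v e = outgoing_deriv G f v e') \<and>
     (\<Sum>e\<in>incident G v. vertex_value G f v e) = 0}"


section \<open>The operators and their eigenvalues\<close>

text \<open>
  An operator is given by its graph, the set of pairs \<open>(f, u)\<close> with \<open>f\<close> in its domain and \<open>u\<close>
  any representative of the image of \<open>f\<close> in \<open>L\<^sup>2\<close>.
\<close>

definition neg_second_deriv_on ::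
  "('v, 'e) mgraph \<Rightarrow> 'e gfun set \<Rightarrow> ('e gfun \<times> 'e gfun) set" where
  "neg_second_deriv_on G D = {(f, u). f \<in> D \<and>
     (\<forall>e\<in>edges G. AE x in lebesgue_on {0..len G e}.
        u e x = - deriv_on (len G e) (deriv_on (len G e) (f e)) x)}"

definition L_st :: "('v, 'e) mgraph \<Rightarrow> ('e gfun \<times> 'e gfun) set" where
  "L_st G = neg_second_deriv_on G (dom_st G)"

definition L_ast :: "('v, 'e) mgraph \<Rightarrow> ('e gfun \<times> 'e gfun) set" where
  "L_ast G = neg_second_deriv_on G (dom_ast G)"

definition eigenspace :: "('e gfun \<times> 'e gfun) set \<Rightarrow> real \<Rightarrow> 'e gfun set" where
  "eigenspace L \<mu> = {f. (f, cscale (complex_of_real \<mu>) f) \<in> L}"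

text \<open>
  The sequence \<open>s 0 \<le> s 1 \<le> \<dots>\<close> lists the eigenvalues, each as often as its (finite)
  multiplicity.
\<close>

definition eigenvalue_enumeration :: "('e gfun \<times> 'e gfun) set \<Rightarrow> (nat \<Rightarrow> real) \<Rightarrow> bool" where
  "eigenvalue_enumeration L s \<longleftrightarrow> mono s \<and>
     (\<forall>\<mu>. finite {k. s k = \<mu>} \<and>
        (\<exists>B. finite B \<and> gfun.independent B \<and> gfun.span B = eigenspace L \<mu> \<and>
             card B = card {k. s k = \<mu>}))"

lemma eigenvalue_enumeration_unique:
  assumes "eigenvalue_enumeration L s" and "eigenvalue_enumeration L s'"
  shows "s = s'"
proof -
  have card_eq: "card {k. s k = \<mu>} = card {k. s' k = \<mu>}" for \<mu>
    using assms unfolding eigenvalue_enumeration_def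
    by (metis gfun.dim_eq_card gfun.dim_span)
  have not_less: "\<not> t k < t' k"
    if "eigenvalue_enumeration L t" "eigenvalue_enumeration L t'"
      and c: "\<And>\<mu>. card {k. t k = \<mu>} = card {k. t' k = \<mu>}"
      and IH: "\<And>i. i < k \<Longrightarrow> t i = t' i" for t t' k
  proof
    assume less: "t k < t' k"
    have "mono t'" and fin: "finite {i. t i = t k}"
      using that(1,2) by (auto simp: eigenvalue_enumeration_def)
    have "{i. t' i = t k} \<subseteq> {i. t i = t k} - {k}"
    proof
      fix i assume "i \<in> {i. t' i = t k}"
      hence i: "t' i = t k" by simp
      hence "\<not> k \<le> i" using less monoD[OF \<open>mono t'\<close>, of k i] by auto
      thus "i \<in> {i. t i = t k} - {k}" using IH[of i] i by auto
    qed
    hence "card {i. t' i = t k} \<le> card ({i. t i = t k} - {k})"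
      using fin by (intro card_mono) auto
    also have "\<dots> < card {i. t i = t k}"
      using fin by (intro card_Diff1_less) auto
    finally show False using c by simp
  qed
  have "s k = s' k" for k
  proof (induction k rule: less_induct)
    case (less k)
    show ?case
      using not_less[OF assms card_eq, of k] less.IH
        not_less[OF assms(2,1) card_eq[symmetric], of k]
      by (metis linorder_neqE)
  qed
  thus ?thesis by (rule ext)
qed

text \<open>The \<open>k\<close>-th eigenvalue, counted from \<open>k = 1\<close>.\<close>

definition eigenvalue :: "nat \<Rightarrow> ('e gfun \<times> 'e gfun) set \<Rightarrow> real" where
  "eigenvalue k L = (THE s. eigenvalue_enumeration L s) (k - 1)"


section \<open>The two graphs are as described\<close>

lemma connected_of_root:
  assumes "\<And>v. v \<in> V \<Longrightarrow> (r, v) \<in> (adjacent G)\<^sup>*" "u \<in> V" "v \<in> V"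
  shows "(u, v) \<in> (adjacent G)\<^sup>*"
proof -
  have "sym (adjacent G)" by (auto simp: sym_def adjacent_def insert_commute)
  thus ?thesis using assms by (metis rtrancl_trans sym_rtrancl symD)
qed

lemma metric_graph_triangle345: "metric_graph triangle345"
proof
  have adj: "(0, 1) \<in> adjacent triangle345" "(0, 2) \<in> adjacent triangle345"
    by (auto simp: adjacent_def ends_def triangle345_def)
  show "(u, v) \<in> (adjacent triangle345)\<^sup>*"
    if "u \<in> verts triangle345" "v \<in> verts triangle345" for u v
    by (rule connected_of_root[of "verts triangle345" 0, OF _ that])
       (use adj in \<open>auto simp: triangle345_def\<close>)
  show "inj_on (ends triangle345) (edges triangle345)"
    by (simp add: ends_def triangle345_def inj_on_def doubleton_eq_iff)
  show "ends triangle345 e \<subseteq> verts triangle345" if "e \<in> edges triangle345" for e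
    using that by (auto simp: ends_def triangle345_def)
  show "tail triangle345 e \<noteq> head triangle345 e" if "e \<in> edges triangle345" for e
    using that by (auto simp: triangle345_def)
  show "0 < len triangle345 e" if "e \<in> edges triangle345" for e
    using that by (auto simp: triangle345_def)
qed (simp_all add: triangle345_def)

lemma verts_unit_triangle345:
  "verts unit_triangle345 = {Inl 0, Inl 1, Inl 2, Inr (0, 1), Inr (0, 2), Inr (1, 1),
     Inr (1, 2), Inr (1, 3), Inr (2, 1), Inr (2, 2), Inr (2, 3), Inr (2, 4)}"
proof -
  have "{0<..<3} = {1, 2::nat}" "{0<..<4} = {1, 2, 3::nat}" "{0<..<5} = {1, 2, 3, 4::nat}"
    by auto
  moreover have "(SIGMA i:insert a A. B i) = Pair a ` B a \<union> (SIGMA i:A. B i)"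
    for a :: nat and A and B :: "nat \<Rightarrow> nat set"
    by auto
  ultimately show ?thesis
    by (simp add: unit_triangle345_def subdivide_def triangle345_def insert_commute)
qed

lemma edges_unit_triangle345:
  "edges unit_triangle345 = {(0, 0), (0, 1), (0, 2), (1, 0), (1, 1), (1, 2), (1, 3),
     (2, 0), (2, 1), (2, 2), (2, 3), (2, 4)}"
proof -
  have "{..<3} = {0, 1, 2::nat}" "{..<4} = {0, 1, 2, 3::nat}" "{..<5} = {0, 1, 2, 3, 4::nat}"
    by auto
  moreover have "(SIGMA i:insert a A. B i) = Pair a ` B a \<union> (SIGMA i:A. B i)"
    for a :: nat and A and B :: "nat \<Rightarrow> nat set"
    by auto
  ultimately show ?thesis
    by (simp add: unit_triangle345_def subdivide_def triangle345_def insert_commute)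
qed

lemma ends_unit_triangle345:
  "ends unit_triangle345 (e, j) =
     {division_point triangle345 (\<lambda>i. [3, 4, 5] ! i) e j,
      division_point triangle345 (\<lambda>i. [3, 4, 5] ! i) e (Suc j)}"
  by (simp add: ends_def unit_triangle345_def subdivide_def)

lemma card_unit_triangle345:
  "card (verts unit_triangle345) = 12" "card (edges unit_triangle345) = 12"
  by (simp_all add: verts_unit_triangle345 edges_unit_triangle345)

lemma len_unit_triangle345: "e \<in> edges unit_triangle345 \<Longrightarrow> len unit_triangle345 e = 1"
  by (auto simp: unit_triangle345_def subdivide_def triangle345_def)

lemma equilateral_unit_triangle345: "equilateral unit_triangle345"
  by (simp add: equilateral_def len_unit_triangle345)

lemma division_point_triangle345:
  "division_point triangle345 (\<lambda>i. [3, 4, 5] ! i) e j =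
     (if j = 0 then Inl e else if j = [3, 4, 5] ! e then Inl ((e + 1) mod 3) else Inr (e, j))"
  by (simp add: division_point_def triangle345_def)

lemma bipartite_unit_triangle345: "bipartite unit_triangle345"
proof -
  let ?A = "{Inl 0, Inr (0, 2), Inr (1, 1), Inr (1, 3), Inr (2, 1), Inr (2, 3)} :: (nat + nat \<times> nat) set"
  let ?B = "{Inl 1, Inl 2, Inr (0, 1), Inr (1, 2), Inr (2, 2), Inr (2, 4)} :: (nat + nat \<times> nat) set"
  have "?A \<inter> ?B = {}" and "?A \<union> ?B = verts unit_triangle345"
    unfolding verts_unit_triangle345 by auto
  moreover have "\<forall>e\<in>edges unit_triangle345. \<exists>a\<in>?A. \<exists>b\<in>?B. ends unit_triangle345 e = {a, b}"
    by (simp add: edges_unit_triangle345 ends_unit_triangle345 division_point_triangle345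
        doubleton_eq_iff)
  ultimately show ?thesis unfolding bipartite_def by blast
qed

lemma metric_graph_unit_triangle345: "metric_graph unit_triangle345"
proof
  have adj: "(division_point triangle345 (\<lambda>i. [3, 4, 5] ! i) e j,
      division_point triangle345 (\<lambda>i. [3, 4, 5] ! i) e (Suc j)) \<in> adjacent unit_triangle345"
    if "(e, j) \<in> edges unit_triangle345" for e j
    using that by (force simp: adjacent_def ends_unit_triangle345)
  note adj = adj[unfolded edges_unit_triangle345 division_point_triangle345]
  note step = rtrancl_into_rtrancl[where r = "adjacent unit_triangle345"]
  have r0: "(Inl 0, Inl 0) \<in> (adjacent unit_triangle345)\<^sup>*" by simp
  have r1: "(Inl 0, Inr (0, 1)) \<in> (adjacent unit_triangle345)\<^sup>*"
    using step[OF r0] adj[of 0 0] by simp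
  have r2: "(Inl 0, Inr (0, 2)) \<in> (adjacent unit_triangle345)\<^sup>*"
    using step[OF r1] adj[of 0 1] by (simp add: numeral_2_eq_2)
  have r3: "(Inl 0, Inl 1) \<in> (adjacent unit_triangle345)\<^sup>*"
    using step[OF r2] adj[of 0 2] by simp
  have r4: "(Inl 0, Inr (1, 1)) \<in> (adjacent unit_triangle345)\<^sup>*"
    using step[OF r3] adj[of 1 0] by simp
  have r5: "(Inl 0, Inr (1, 2)) \<in> (adjacent unit_triangle345)\<^sup>*"
    using step[OF r4] adj[of 1 1] by (simp add: numeral_2_eq_2)
  have r6: "(Inl 0, Inr (1, 3)) \<in> (adjacent unit_triangle345)\<^sup>*"
    using step[OF r5] adj[of 1 2] by simp
  have r7: "(Inl 0, Inl 2) \<in> (adjacent unit_triangle345)\<^sup>*"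
    using step[OF r6] adj[of 1 3] by (simp add: numeral_2_eq_2)
  have r8: "(Inl 0, Inr (2, 1)) \<in> (adjacent unit_triangle345)\<^sup>*"
    using step[OF r7] adj[of 2 0] by simp
  have r9: "(Inl 0, Inr (2, 2)) \<in> (adjacent unit_triangle345)\<^sup>*"
    using step[OF r8] adj[of 2 1] by (simp add: numeral_2_eq_2)
  have r10: "(Inl 0, Inr (2, 3)) \<in> (adjacent unit_triangle345)\<^sup>*"
    using step[OF r9] adj[of 2 2] by simp
  have r11: "(Inl 0, Inr (2, 4)) \<in> (adjacent unit_triangle345)\<^sup>*"
    using step[OF r10] adj[of 2 3] by simp
  show "(u, v) \<in> (adjacent unit_triangle345)\<^sup>*"
    if "u \<in> verts unit_triangle345" "v \<in> verts unit_triangle345" for u v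
    by (rule connected_of_root[of "verts unit_triangle345" "Inl 0", OF _ that])
       (use r0 r1 r2 r3 r4 r5 r6 r7 r8 r9 r10 r11 in \<open>auto simp: verts_unit_triangle345\<close>)
  show "inj_on (ends unit_triangle345) (edges unit_triangle345)"
    by (simp add: inj_on_def edges_unit_triangle345 ends_unit_triangle345 division_point_triangle345
        doubleton_eq_iff)
  show "ends unit_triangle345 e \<subseteq> verts unit_triangle345" if "e \<in> edges unit_triangle345" for e
    using that
    by (auto simp: edges_unit_triangle345 verts_unit_triangle345 ends_unit_triangle345
        division_point_triangle345)
  show "tail unit_triangle345 e \<noteq> head unit_triangle345 e" if "e \<in> edges unit_triangle345" for e
    using that unfolding edges_unit_triangle345
    by (auto simp: unit_triangle345_def subdivide_def division_point_triangle345)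
qed (simp_all add: verts_unit_triangle345 edges_unit_triangle345 len_unit_triangle345)

text \<open>Connected and every vertex of degree two: a cycle.\<close>

lemma card_incident_unit_triangle345:
  assumes "v \<in> verts unit_triangle345"
  shows "card (incident unit_triangle345 v) = 2"
proof -
  have "incident unit_triangle345 v =
      edges unit_triangle345 \<inter> {e. v \<in> ends unit_triangle345 e}"
    by (auto simp: incident_def)
  thus ?thesis
    using assms unfolding verts_unit_triangle345 edges_unit_triangle345
    by (elim insertE emptyE)
       (simp_all add: ends_unit_triangle345 division_point_triangle345)
qed

end

(* On a cycle every vertex has degree two, so the standard conditions say that f and f' continue
   across each vertex, and the anti-standard ones that both change sign there. An eigenfunction for
   w^2 is therefore a combination of exp(iwt) and exp(-iwt) in the arc length t, multiplied by the
   accumulated signs, and it closes up iff s^n exp(iwT) = 1, where T = 12 is the total length, n the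
   number of edges and s = 1 or -1. For n = 12 both operators have the periodic spectrum; for n = 3
   the standard one is periodic and the anti-standard one antiperiodic. Hence the frequencies are
   2 pi m / 12, or pi (2m + 1) / 12, and they interlace.

   The eigenvalue equation is only given almost everywhere, with an unspecified value of the
   derivative where it does not exist. Turning it into a differential equation needs the almost
   everywhere differentiability of absolutely continuous functions. This follows from Vitali's
   covering theorem: on the set where F has difference quotients above q and below p < q on
   arbitrarily small intervals, two nearly equal finite unions of intervals would have increments of
   F differing by a definite amount, which absolute continuity forbids. *)

theory Submission
  imports Defs
begin

section \<open>Absolutely continuous functions\<close>

text \<open>Because values and oriented derivatives pick up the same sign at a vertex,
  \<open>u = f' + i w f\<close> is multiplied by \<open>exp(i w x)\<close> along an edge and by
  \<open>s\<close> across a vertex. One turn round the cycle is therefore multiplication of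
  \<open>u\<close> by a number, not by a matrix, and \<open>f\<close> is recovered from the two
  functions belonging to \<open>w\<close> and \<open>- w\<close>. This fails only for
  \<open>w = 0\<close>, where \<open>f\<close> is affine on each edge and the slope has to be
  excluded by hand. Taking \<open>w\<close> complex lets the same argument rule out negative
  eigenvalues. The vertex conditions read off derivatives at the ends of the edges, so the
  differential equation is needed on the closed interval; it is obtained by comparing
  \<open>f'\<close> with the primitive of the continuous function \<open>- w^2 f\<close>. Both
  graphs have length 12, so their standard operators share one spectrum, and 12 being even gives the
  same one for the anti-standard operator on the subdivision. Hence both inequalities are a single
  comparison between entry \<open>k - 1\<close> of the antiperiodic list and entry \<open>k\<close>
  of the periodic one, lists being indexed from 0.\<close>

definition incr :: "(real \<Rightarrow> real) \<Rightarrow> real set \<Rightarrow> real" where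
  "incr F K = F (Sup K) - F (Inf K)"

lemma incr_Icc: "u \<le> v \<Longrightarrow> incr F {u..v} = F v - F u"
  by (simp add: incr_def)

text \<open>Stated with divisions rather than sequences of intervals because Vitali's theorem yields
  finite sets of closed intervals and because divisions can be joined and completed; only their
  interiors have to be disjoint.\<close>

definition ac_on :: "real \<Rightarrow> real \<Rightarrow> (real \<Rightarrow> real) \<Rightarrow> bool" where
  "ac_on a b F \<longleftrightarrow> (\<forall>\<epsilon>>0. \<exists>\<delta>>0. \<forall>D. D division_of \<Union>D \<longrightarrow> \<Union>D \<subseteq> {a..b} \<longrightarrow>
     measure lebesgue (\<Union>D) < \<delta> \<longrightarrow> (\<Sum>K\<in>D. \<bar>incr F K\<bar>) < \<epsilon>)"

lemma ac_onD:
  assumes "ac_on a b F" "\<epsilon> > 0"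
  obtains \<delta> where "\<delta> > 0"
    "\<And>D. \<lbrakk>D division_of \<Union>D; \<Union>D \<subseteq> {a..b}; measure lebesgue (\<Union>D) < \<delta>\<rbrakk> \<Longrightarrow> (\<Sum>K\<in>D. \<bar>incr F K\<bar>) < \<epsilon>"
  using assms unfolding ac_on_def by meson

lemma division_Icc:
  assumes "D division_of S" "K \<in> D"
  obtains u v :: real where "u \<le> v" "K = {u..v}"
proof -
  obtain u v where "K = cbox u v" using division_ofD(4)[OF assms] by blast
  moreover have "K \<noteq> {}" using division_ofD(3)[OF assms] .
  ultimately show ?thesis using that by auto
qed

lemma sum_incr_division:
  assumes "D division_of {a..b}" "a \<le> b"
  shows "(\<Sum>K\<in>D. incr F K) = F b - F a"
proof -
  \<comment> \<open>Operativity demands the value 0 on the empty interval, where \<open>Sup\<close>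
    and \<open>Inf\<close> carry no information.\<close>
  let ?f = "\<lambda>K::real set. if K = {} then 0 else incr F K"
  interpret operative_real plus 0 ?f
    rewrites "comm_monoid_set.F (+) 0 = sum"
    by standard[1] (auto simp add: sum_def incr_def)
  have "sum ?f D = ?f {a..b}"
    using division[of D a b] assms(1) by simp
  moreover have "sum ?f D = sum (incr F) D"
    by (intro sum.cong) (use division_ofD(3)[OF assms(1)] in auto)
  ultimately show ?thesis using assms(2) by (simp add: incr_Icc)
qed

text \<open>\<open>T\<close> need not be an interval, so the sum does not telescope directly. The
  rest of \<open>{a..b}\<close> is filled by one fixed family \<open>R - D\<close>; together with
  any division of \<open>T\<close> it divides \<open>{a..b}\<close>, where the total is
  \<open>F b - F a\<close>.\<close>

lemma sum_incr_division_unique: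
  fixes F :: "real \<Rightarrow> real"
  assumes D: "D division_of T" and D': "D' division_of T" and T: "T \<subseteq> {a..b}"
  shows "(\<Sum>K\<in>D. incr F K) = (\<Sum>K\<in>D'. incr F K)"
proof (cases "a \<le> b")
  case True
  have "{cbox a b} division_of cbox a b" using True by (intro division_of_self) auto
  then obtain R where R: "D \<subseteq> R" "R division_of {a..b}"
    using partial_division_extend[OF D _ T, of "{{a..b}}"] by (metis box_real(2))
  let ?Q = "R - D"
  have Q: "?Q division_of \<Union>?Q" using R(2) by (meson Diff_subset division_of_subset division_of_union_self)
  have int: "interior (\<Union>?Q) \<inter> interior T = {}"
  proof -
    have "interior T \<inter> interior (\<Union>?Q) = {}"
    proof (rule Int_interior_Union_intervals)
      show "finite ?Q" using Q division_ofD(1) by blast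
      show "\<And>K. K \<in> ?Q \<Longrightarrow> \<exists>a b. K = cbox a b" using division_ofD(4)[OF R(2)] by blast
      show "open (interior T)" by simp
      fix K assume K: "K \<in> ?Q"
      have "interior K \<inter> interior (\<Union>D) = {}"
      proof (rule Int_interior_Union_intervals)
        show "finite D" using D division_ofD(1) by blast
        show "\<And>K. K \<in> D \<Longrightarrow> \<exists>a b. K = cbox a b" using division_ofD(4)[OF D] by blast
        show "\<And>K'. K' \<in> D \<Longrightarrow> interior K \<inter> interior K' = {}"
          using division_ofD(5)[OF R(2)] K R(1) by blast
      qed simp
      thus "interior T \<inter> interior K = {}" using division_ofD(6)[OF D] by auto
    qed
    thus ?thesis by auto
  qed
  have TQ: "\<Union>?Q \<union> T = {a..b}"
    using division_ofD(6)[OF R(2)] division_ofD(6)[OF D] R(1) by blast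
  \<comment> \<open>The two divisions can only share degenerate intervals.\<close>
  have inter: "incr F K = 0" if K: "K \<in> ?Q \<inter> D''" and D'': "D'' division_of T" for K D''
  proof -
    obtain u v where uv: "u \<le> v" "K = {u..v}" using division_Icc[OF D''] K by blast
    have "K \<subseteq> T" using division_ofD(2)[OF D''] K by blast
    moreover have "K \<subseteq> \<Union>?Q" using K by blast
    ultimately have "interior K = {}" using int by (metis Int_greatest interior_mono subset_empty)
    hence "u = v" using uv by auto
    thus ?thesis using uv by (simp add: incr_def)
  qed
  have total: "(\<Sum>K\<in>?Q. incr F K) + (\<Sum>K\<in>D''. incr F K) = F b - F a" if "D'' division_of T" for D''
  proof -
    have "finite ?Q" "finite D''" using Q that division_ofD(1) by blast+
    hence "(\<Sum>K\<in>?Q. incr F K) + (\<Sum>K\<in>D''. incr F K) = (\<Sum>K\<in>?Q \<union> D''. incr F K) + (\<Sum>K\<in>?Q \<inter> D''. incr F K)"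
      by (simp add: sum.union_inter)
    also have "(\<Sum>K\<in>?Q \<inter> D''. incr F K) = 0"
      by (intro sum.neutral) (use inter that in blast)
    also have "(?Q \<union> D'') division_of {a..b}"
      using division_disjoint_union[OF Q that int] TQ by simp
    hence "(\<Sum>K\<in>?Q \<union> D''. incr F K) = F b - F a"
      by (rule sum_incr_division) (rule True)
    finally show ?thesis by simp
  qed
  show ?thesis using total[OF D] total[OF D'] by simp
next
  case False
  hence "T = {}" using T by auto
  hence "D = {}" "D' = {}" using D D' by auto
  thus ?thesis by simp
qed

text \<open>Both families are completed to divisions of the union of the two sets. The added pieces
  have small measure, so absolute continuity makes their increments small, and the two completed
  sums agree since they divide the same set.\<close>

lemma ac_on_sum_close:
  assumes F: "ac_on a b F" and "\<epsilon> > 0"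
  obtains \<delta> where "\<delta> > 0"
    "\<And>A B. \<lbrakk>A division_of \<Union>A; B division_of \<Union>B; \<Union>A \<subseteq> {a..b}; \<Union>B \<subseteq> {a..b};
       measure lebesgue (\<Union>A - \<Union>B) < \<delta>; measure lebesgue (\<Union>B - \<Union>A) < \<delta>\<rbrakk> \<Longrightarrow>
       \<bar>(\<Sum>K\<in>A. incr F K) - (\<Sum>K\<in>B. incr F K)\<bar> < \<epsilon>"
proof -
  obtain \<delta> where \<delta>: "\<delta> > 0"
    "\<And>D. \<lbrakk>D division_of \<Union>D; \<Union>D \<subseteq> {a..b}; measure lebesgue (\<Union>D) < \<delta>\<rbrakk> \<Longrightarrow> (\<Sum>K\<in>D. \<bar>incr F K\<bar>) < \<epsilon> / 2"
    by (rule ac_onD[OF F half_gt_zero[OF assms(2)]]) blast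
  have extend: "\<exists>R. R division_of T \<and> \<bar>(\<Sum>K\<in>R. incr F K) - (\<Sum>K\<in>A. incr F K)\<bar> < \<epsilon> / 2"
    if A: "A division_of \<Union>A" and T: "P division_of T" "T \<subseteq> {a..b}" "\<Union>A \<subseteq> T"
      and m: "measure lebesgue (T - \<Union>A) < \<delta>" for A T P
  proof -
    obtain R where R: "A \<subseteq> R" "R division_of T"
      using partial_division_extend[OF A T(1,3)] by blast
    let ?Q = "R - A"
    have Q: "?Q division_of \<Union>?Q" using R(2) by (meson Diff_subset division_of_subset division_of_union_self)
    have fin: "finite R" using R(2) division_ofD(1) by blast
    have sub: "\<Union>?Q \<subseteq> T" using division_ofD(6)[OF R(2)] by auto
    have ms: "(\<Sum>K\<in>R. measure lebesgue K) = measure lebesgue T" "(\<Sum>K\<in>A. measure lebesgue K) = measure lebesgue (\<Union>A)"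
      "(\<Sum>K\<in>?Q. measure lebesgue K) = measure lebesgue (\<Union>?Q)"
      using content_division R(2) A Q by blast+
    have "measure lebesgue (\<Union>?Q) = measure lebesgue T - measure lebesgue (\<Union>A)"
      using fin R(1) by (simp flip: ms add: sum_diff)
    also have "\<dots> = measure lebesgue (T - \<Union>A)"
      using T(3) lmeasurable_division[OF R(2)] lmeasurable_division[OF A]
      by (intro measurable_measure_Diff[symmetric]) auto
    finally have "(\<Sum>K\<in>?Q. \<bar>incr F K\<bar>) < \<epsilon> / 2"
      using \<delta>(2)[OF Q] sub T(2) m by auto
    moreover have "(\<Sum>K\<in>R. incr F K) - (\<Sum>K\<in>A. incr F K) = (\<Sum>K\<in>?Q. incr F K)"
      using fin R(1) by (simp add: sum_diff)
    moreover have "\<bar>\<Sum>K\<in>?Q. incr F K\<bar> \<le> (\<Sum>K\<in>?Q. \<bar>incr F K\<bar>)" by (rule sum_abs)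
    ultimately show ?thesis using R(2) by (intro exI[of _ R]) linarith
  qed
  show ?thesis
  proof (rule that[OF \<delta>(1)])
    fix A B assume *: "A division_of \<Union>A" "B division_of \<Union>B" "\<Union>A \<subseteq> {a..b}" "\<Union>B \<subseteq> {a..b}"
       "measure lebesgue (\<Union>A - \<Union>B) < \<delta>" "measure lebesgue (\<Union>B - \<Union>A) < \<delta>"
    let ?T = "\<Union>A \<union> \<Union>B"
    obtain P where P: "P division_of ?T" using elementary_union[OF *(1,2)] by blast
    have T: "?T - \<Union>A = \<Union>B - \<Union>A" "?T - \<Union>B = \<Union>A - \<Union>B" "?T \<subseteq> {a..b}" using * by auto
    obtain R where R: "R division_of ?T" "\<bar>(\<Sum>K\<in>R. incr F K) - (\<Sum>K\<in>A. incr F K)\<bar> < \<epsilon> / 2"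
      using extend[OF *(1) P T(3)] T * by auto
    obtain R' where R': "R' division_of ?T" "\<bar>(\<Sum>K\<in>R'. incr F K) - (\<Sum>K\<in>B. incr F K)\<bar> < \<epsilon> / 2"
      using extend[OF *(2) P T(3)] T * by auto
    have "(\<Sum>K\<in>R. incr F K) = (\<Sum>K\<in>R'. incr F K)"
      by (rule sum_incr_division_unique[OF R(1) R'(1) T(3)])
    thus "\<bar>(\<Sum>K\<in>A. incr F K) - (\<Sum>K\<in>B. incr F K)\<bar> < \<epsilon>" using R(2) R'(2) by linarith
  qed
qed

text \<open>Intervals are regarded as balls to apply Vitali's theorem, which covers \<open>S\<close>
  up to a null set by countably many disjoint ones; finitely many of them already exhaust
  \<open>S\<close> up to measure \<open>\<eta>\<close>. The open set \<open>U\<close> lets the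
  caller control how far the intervals stick out of \<open>S\<close>.\<close>

lemma vitali_division:
  fixes S :: "real set"
  assumes S: "S \<in> lmeasurable" and U: "open U" "S \<subseteq> U" and "\<eta> > 0"
    and P: "\<And>x d. x \<in> S \<Longrightarrow> d > 0 \<Longrightarrow> \<exists>u v. u < v \<and> u \<le> x \<and> x \<le> v \<and> v - u < d \<and> P u v"
  obtains D where "D division_of \<Union>D" "\<Union>D \<subseteq> U"
    "\<And>K. K \<in> D \<Longrightarrow> \<exists>u v. u < v \<and> K = {u..v} \<and> P u v" "measure lebesgue (S - \<Union>D) < \<eta>"
proof -
  define I where "I = {(u, v). u < v \<and> P u v \<and> {u..v} \<subseteq> U}"
  define c where "c = (\<lambda>(u, v). (u + v) / 2 :: real)"
  define r where "r = (\<lambda>(u, v). (v - u) / 2 :: real)"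
  have cb: "cball (c p) (r p) = {fst p..snd p}" for p
    by (auto simp: c_def r_def cball_eq_atLeastAtMost field_simps split: prod.splits)
  have ex: "\<exists>i. i \<in> I \<and> x \<in> cball (c i) (r i) \<and> r i < d" if x: "x \<in> S" "0 < d" for x d
  proof -
    obtain e where e: "e > 0" "ball x e \<subseteq> U" using U x by (meson open_contains_ball subsetD)
    obtain u v where uv: "u < v" "u \<le> x" "x \<le> v" "v - u < min d e" "P u v"
      using P[OF x(1), of "min d e"] x e by auto
    have "{u..v} \<subseteq> ball x e" using uv by (auto simp: dist_real_def)
    hence "(u, v) \<in> I" using uv e by (auto simp: I_def)
    thus ?thesis using uv unfolding cb by (intro exI[of _ "(u, v)"]) (auto simp: r_def)
  qed
  obtain C where C: "countable C" "C \<subseteq> I"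
     "pairwise (\<lambda>i j. disjnt (cball (c i) (r i)) (cball (c j) (r j))) C"
     "negligible (S - (\<Union>i \<in> C. cball (c i) (r i)))"
  proof (rule Vitali_covering_theorem_cballs[of I r S c])
    show "0 < r i" if "i \<in> I" for i using that by (auto simp: I_def r_def)
  qed (use ex in blast)+
  let ?J = "\<lambda>p::real\<times>real. {fst p..snd p}"
  \<comment> \<open>Intersecting with \<open>S\<close> bounds the measure of every finite union by
    that of \<open>S\<close>, as the passage to a finite subfamily requires; \<open>U\<close> itself
    may have infinite measure.\<close>
  let ?DD = "(\<lambda>p. S \<inter> ?J p) ` C"
  have mS: "S \<inter> ?J p \<in> lmeasurable" for p using S by (intro fmeasurable_Int_fmeasurable) auto
  obtain D' where D': "D' \<subseteq> ?DD" "finite D'" "measure lebesgue (\<Union>?DD) - \<eta> < measure lebesgue (\<Union>D')"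
  proof (rule measure_countable_Union_approachable[of ?DD \<eta> "measure lebesgue S"])
    show "measure lebesgue (\<Union>D') \<le> measure lebesgue S" if "D' \<subseteq> ?DD" "finite D'" for D'
    proof (rule measure_mono_fmeasurable)
      have "\<Union>D' \<in> lmeasurable" using that mS by (intro fmeasurable.finite_Union) auto
      thus "\<Union>D' \<in> sets lebesgue" by blast
    qed (use that S in auto)
  qed (use C(1) assms(4) mS in auto)
  obtain C' where C': "C' \<subseteq> C" "finite C'" "D' = (\<lambda>p. S \<inter> ?J p) ` C'"
    using finite_subset_image[OF D'(2,1)] by blast
  define D where "D = ?J ` C'"
  have neg: "negligible (S - \<Union>?DD)"
    using C(4) by (rule negligible_subset) (auto simp: cb)
  have UD: "\<Union>D' = S \<inter> \<Union>D" unfolding C'(3) D_def by auto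
  have mD': "\<Union>D' \<in> lmeasurable" using D' mS by (intro fmeasurable.finite_Union) auto
  have mDD: "\<Union>?DD \<in> lmeasurable"
  proof (rule fmeasurableI2[OF S])
    show "\<Union>?DD \<in> sets lebesgue" using mS C(1) by (intro sets.countable_UN') (auto dest: fmeasurableD)
  qed auto
  show ?thesis
  proof (rule that)
    show "D division_of \<Union>D"
    proof (rule division_ofI)
      show "finite D" using C' by (simp add: D_def)
      fix K assume "K \<in> D"
      then obtain p where p: "p \<in> C" "K = ?J p" using C' by (auto simp: D_def)
      thus "K \<noteq> {}" using C(2) by (auto simp: I_def)
      show "\<exists>a b. K = cbox a b" using p by auto
      fix K' assume "K' \<in> D" "K \<noteq> K'"
      then obtain p' where p': "p' \<in> C" "K' = ?J p'" "p \<noteq> p'" using C' p by (auto simp: D_def)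
      have "disjnt (?J p) (?J p')" using C(3) p p' unfolding cb by (meson pairwiseD)
      thus "interior K \<inter> interior K' = {}" using p p' interior_subset unfolding disjnt_def by blast
    qed auto
    show "\<Union>D \<subseteq> U" using C(2) C'(1) by (force simp: D_def I_def)
    show "\<exists>u v. u < v \<and> K = {u..v} \<and> P u v" if "K \<in> D" for K
      using C(2) C'(1) that by (force simp: D_def I_def)
    have "measure lebesgue (S - \<Union>D) = measure lebesgue (S - \<Union>D')" using UD by (simp add: Diff_Int)
    also have "\<dots> = measure lebesgue S - measure lebesgue (\<Union>D')"
      using S mD' UD by (intro measurable_measure_Diff) auto
    also have "measure lebesgue S = measure lebesgue (\<Union>?DD)"
    proof -
      have "measure lebesgue (S - \<Union>?DD) = 0" using neg negligible_imp_measure0 by blast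
      moreover have "measure lebesgue (S - \<Union>?DD) = measure lebesgue S - measure lebesgue (\<Union>?DD)"
        using S mDD by (intro measurable_measure_Diff) auto
      ultimately show ?thesis by simp
    qed
    finally show "measure lebesgue (S - \<Union>D) < \<eta>" using D'(3) by simp
  qed
qed

section \<open>Closure properties, and constancy under an almost everywhere vanishing
  derivative\<close>

lemma ac_on_uminus: "ac_on a b F \<Longrightarrow> ac_on a b (\<lambda>x. - F x)"
proof -
  have "\<bar>incr (\<lambda>x. - F x) K\<bar> = \<bar>incr F K\<bar>" for K by (simp add: incr_def)
  thus "ac_on a b F \<Longrightarrow> ac_on a b (\<lambda>x. - F x)" by (simp add: ac_on_def)
qed

lemma ac_on_diff:
  assumes "ac_on a b F" "ac_on a b G"
  shows "ac_on a b (\<lambda>x. F x - G x)"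
  unfolding ac_on_def
proof (intro allI impI)
  fix \<epsilon> :: real assume "\<epsilon> > 0"
  hence e: "\<epsilon> / 2 > 0" by simp
  obtain \<delta>1 where 1: "\<delta>1 > 0"
    "\<And>D. \<lbrakk>D division_of \<Union>D; \<Union>D \<subseteq> {a..b}; measure lebesgue (\<Union>D) < \<delta>1\<rbrakk> \<Longrightarrow> (\<Sum>K\<in>D. \<bar>incr F K\<bar>) < \<epsilon> / 2"
    by (rule ac_onD[OF assms(1) e]) blast
  obtain \<delta>2 where 2: "\<delta>2 > 0"
    "\<And>D. \<lbrakk>D division_of \<Union>D; \<Union>D \<subseteq> {a..b}; measure lebesgue (\<Union>D) < \<delta>2\<rbrakk> \<Longrightarrow> (\<Sum>K\<in>D. \<bar>incr G K\<bar>) < \<epsilon> / 2"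
    by (rule ac_onD[OF assms(2) e]) blast
  have "(\<Sum>K\<in>D. \<bar>incr (\<lambda>x. F x - G x) K\<bar>) < \<epsilon>"
    if D: "D division_of \<Union>D" "\<Union>D \<subseteq> {a..b}" "measure lebesgue (\<Union>D) < min \<delta>1 \<delta>2" for D
  proof -
    have "(\<Sum>K\<in>D. \<bar>incr (\<lambda>x. F x - G x) K\<bar>) \<le> (\<Sum>K\<in>D. \<bar>incr F K\<bar> + \<bar>incr G K\<bar>)"
      by (intro sum_mono) (simp add: incr_def)
    also have "\<dots> < \<epsilon>" using 1(2)[OF D(1,2)] 2(2)[OF D(1,2)] D(3) by (simp add: sum.distrib)
    finally show ?thesis .
  qed
  thus "\<exists>\<delta>>0. \<forall>D. D division_of \<Union>D \<longrightarrow> \<Union>D \<subseteq> {a..b} \<longrightarrow>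
     measure lebesgue (\<Union>D) < \<delta> \<longrightarrow> (\<Sum>K\<in>D. \<bar>incr (\<lambda>x. F x - G x) K\<bar>) < \<epsilon>"
    using 1(1) 2(1) by (intro exI[of _ "min \<delta>1 \<delta>2"]) auto
qed

lemma ac_on_subinterval: "ac_on a b F \<Longrightarrow> a \<le> c \<Longrightarrow> d \<le> b \<Longrightarrow> ac_on c d F"
  unfolding ac_on_def by (meson atLeastatMost_subset_iff order_trans)

lemma measure_Union_division:
  assumes "D division_of S"
  shows "measure lebesgue S = (\<Sum>K\<in>D. Sup K - Inf K)"
proof -
  have "measure lebesgue S = (\<Sum>K\<in>D. measure lebesgue K)" using content_division[OF assms] by simp
  also have "\<dots> = (\<Sum>K\<in>D. Sup K - Inf K)"
  proof (rule sum.cong)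
    fix K assume "K \<in> D"
    from division_Icc[OF assms this] show "measure lebesgue K = Sup K - Inf K" by force
  qed simp
  finally show ?thesis .
qed

text \<open>Needed for primitives of bounded functions. In the proof
  \<open>\<bar>C\<bar> + 1\<close> replaces \<open>C\<close> so that the division by it is
  harmless.\<close>

lemma ac_on_lipschitz:
  assumes "\<And>x y. a \<le> x \<Longrightarrow> x \<le> y \<Longrightarrow> y \<le> b \<Longrightarrow> \<bar>H y - H x\<bar> \<le> C * (y - x)"
  shows "ac_on a b H"
  unfolding ac_on_def
proof (intro allI impI)
  fix \<epsilon> :: real assume e: "\<epsilon> > 0"
  have "(\<Sum>K\<in>D. \<bar>incr H K\<bar>) < \<epsilon>"
    if D: "D division_of \<Union>D" "\<Union>D \<subseteq> {a..b}" "measure lebesgue (\<Union>D) < \<epsilon> / (\<bar>C\<bar> + 1)" for D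
  proof -
    have "(\<Sum>K\<in>D. \<bar>incr H K\<bar>) \<le> (\<Sum>K\<in>D. (\<bar>C\<bar> + 1) * (Sup K - Inf K))"
    proof (rule sum_mono)
      fix K assume K: "K \<in> D"
      then obtain u v where uv: "u \<le> v" "K = {u..v}" using division_Icc[OF D(1)] by blast
      hence "{u..v} \<subseteq> {a..b}" using D(2) K by blast
      hence "\<bar>H v - H u\<bar> \<le> C * (v - u)" using uv by (intro assms) auto
      also have "\<dots> \<le> (\<bar>C\<bar> + 1) * (v - u)" using uv by (intro mult_right_mono) auto
      finally show "\<bar>incr H K\<bar> \<le> (\<bar>C\<bar> + 1) * (Sup K - Inf K)" using uv by (simp add: incr_Icc)
    qed
    also have "\<dots> = (\<bar>C\<bar> + 1) * measure lebesgue (\<Union>D)"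
      by (simp add: measure_Union_division[OF D(1)] sum_distrib_left)
    also have "\<dots> < \<epsilon>" using D(3) by (simp add: field_simps)
    finally show ?thesis .
  qed
  thus "\<exists>\<delta>>0. \<forall>D. D division_of \<Union>D \<longrightarrow> \<Union>D \<subseteq> {a..b} \<longrightarrow>
     measure lebesgue (\<Union>D) < \<delta> \<longrightarrow> (\<Sum>K\<in>D. \<bar>incr H K\<bar>) < \<epsilon>"
    using e by (intro exI[of _ "\<epsilon> / (\<bar>C\<bar> + 1)"]) auto
qed

lemma ac_on_modulus:
  assumes "ac_on a b F" "\<epsilon> > 0"
  obtains \<delta> where "\<delta> > 0" "\<And>x y. a \<le> x \<Longrightarrow> x \<le> y \<Longrightarrow> y \<le> b \<Longrightarrow> y - x < \<delta> \<Longrightarrow> \<bar>F y - F x\<bar> < \<epsilon>"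
proof -
  obtain \<delta> where \<delta>: "\<delta> > 0"
    "\<And>D. \<lbrakk>D division_of \<Union>D; \<Union>D \<subseteq> {a..b}; measure lebesgue (\<Union>D) < \<delta>\<rbrakk> \<Longrightarrow> (\<Sum>K\<in>D. \<bar>incr F K\<bar>) < \<epsilon>"
    by (rule ac_onD[OF assms]) blast
  have "\<bar>F y - F x\<bar> < \<epsilon>" if "a \<le> x" "x \<le> y" "y \<le> b" "y - x < \<delta>" for x y
  proof -
    have "{{x..y}} division_of \<Union>{{x..y}}" using division_of_self[of x y] that by simp
    thus ?thesis using \<delta>(2)[of "{{x..y}}"] that by (simp add: incr_Icc)
  qed
  thus ?thesis using that \<delta>(1) by blast
qed

lemma ac_on_isCont:
  assumes "ac_on a b F" "a < x" "x < b"
  shows "isCont F x"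
  unfolding continuous_at_eps_delta
proof (intro allI impI)
  fix e :: real assume "e > 0"
  then obtain \<delta> where \<delta>: "\<delta> > 0" "\<And>x y. a \<le> x \<Longrightarrow> x \<le> y \<Longrightarrow> y \<le> b \<Longrightarrow> y - x < \<delta> \<Longrightarrow> \<bar>F y - F x\<bar> < e"
    using ac_on_modulus[OF assms(1)] by blast
  let ?d = "min \<delta> (min (x - a) (b - x))"
  have "\<bar>F y - F x\<bar> < e" if "\<bar>y - x\<bar> < ?d" for y
    using \<delta>(2)[of x y] \<delta>(2)[of y x] that by (cases "x \<le> y") (auto simp: abs_minus_commute)
  thus "\<exists>d>0. \<forall>y. dist y x < d \<longrightarrow> dist (F y) (F x) < e"
    using \<delta>(1) assms by (intro exI[of _ ?d]) (auto simp: dist_real_def)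
qed

text \<open>Almost all of \<open>{a..b}\<close> is covered by disjoint intervals on which
  \<open>W\<close> changes by at most \<open>\<epsilon>\<close> times the length. Their increments
  add up to at most \<open>\<epsilon> * (b - a)\<close>, and the uncovered part contributes less
  than \<open>\<epsilon>\<close> by absolute continuity.\<close>

lemma ac_on_constant:
  assumes W: "ac_on a b W" and "a \<le> b" and N: "negligible N"
    and der: "\<And>x. x \<in> {a<..<b} - N \<Longrightarrow> (W has_real_derivative 0) (at x)"
  shows "W b = W a"
proof -
  have small: "\<bar>W b - W a\<bar> \<le> \<epsilon> * (b - a + 1)" if e: "\<epsilon> > 0" for \<epsilon>
  proof -
    obtain \<delta> where \<delta>: "\<delta> > 0" "\<And>A B. \<lbrakk>A division_of \<Union>A; B division_of \<Union>B; \<Union>A \<subseteq> {a..b}; \<Union>B \<subseteq> {a..b};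
       measure lebesgue (\<Union>A - \<Union>B) < \<delta>; measure lebesgue (\<Union>B - \<Union>A) < \<delta>\<rbrakk> \<Longrightarrow>
       \<bar>(\<Sum>K\<in>A. incr W K) - (\<Sum>K\<in>B. incr W K)\<bar> < \<epsilon>"
      by (rule ac_on_sum_close[OF W e]) blast
    let ?S = "{a<..<b} - N"
    have N': "N \<in> null_sets lebesgue" using N negligible_iff_null_sets by blast
    have S: "?S \<in> lmeasurable"
      by (rule fmeasurable_Diff) (use N' in \<open>auto simp: null_sets_def\<close>)
    have P: "\<exists>u v. u < v \<and> u \<le> x \<and> x \<le> v \<and> v - u < d \<and> \<bar>W v - W u\<bar> \<le> \<epsilon> * (v - u)"
      if x: "x \<in> ?S" "d > 0" for x d
    proof -
      have "(W has_derivative (\<lambda>h. 0)) (at x)"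
        using der[OF x(1)] by (simp add: has_field_derivative_def lambda_zero)
      then obtain e' where e': "e' > 0" "\<And>y. norm (y - x) < e' \<Longrightarrow> norm (W y - W x - 0) \<le> \<epsilon> * norm (y - x)"
        unfolding has_derivative_at_alt using e by blast
      let ?y = "x + min e' d / 2"
      show ?thesis using e'(2)[of ?y] e'(1) x(2) by (intro exI[of _ x] exI[of _ ?y]) auto
    qed
    obtain D where D: "D division_of \<Union>D" "\<Union>D \<subseteq> {a<..<b}"
      "\<And>K. K \<in> D \<Longrightarrow> \<exists>u v. u < v \<and> K = {u..v} \<and> \<bar>W v - W u\<bar> \<le> \<epsilon> * (v - u)" "measure lebesgue (?S - \<Union>D) < \<delta>"
    proof (rule vitali_division[OF S _ _ \<delta>(1), where U = "{a<..<b}" and P = "\<lambda>u v. \<bar>W v - W u\<bar> \<le> \<epsilon> * (v - u)"])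
      show "\<exists>u v. u < v \<and> u \<le> x \<and> x \<le> v \<and> v - u < d \<and> \<bar>W v - W u\<bar> \<le> \<epsilon> * (v - u)"
        if "x \<in> ?S" "d > 0" for x d using P[OF that] .
      show "open {a<..<b}" by simp
      show "?S \<subseteq> {a<..<b}" by blast
    qed blast
    have Dab: "\<Union>D \<subseteq> {a..b}" using D(2) by force
    have dab: "{{a..b}} division_of \<Union>{{a..b}}" using division_of_self[of a b] assms(2) by simp
    have "measure lebesgue ({a..b} - \<Union>D) = measure lebesgue (?S - \<Union>D)"
    proof (rule measure_negligible_symdiff)
      have "negligible (N \<union> {a, b})" using N by auto
      thus "negligible (sym_diff (?S - \<Union>D) ({a..b} - \<Union>D))" by (rule negligible_subset) auto
      show "?S - \<Union>D \<in> lmeasurable" using S lmeasurable_division[OF D(1)] by auto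
    qed
    hence "\<bar>(\<Sum>K\<in>D. incr W K) - (\<Sum>K\<in>{{a..b}}. incr W K)\<bar> < \<epsilon>"
      using D Dab \<delta>(1) by (intro \<delta>(2)[OF D(1) dab]) (auto simp: Diff_eq_empty_iff[THEN iffD2])
    moreover have "\<bar>\<Sum>K\<in>D. incr W K\<bar> \<le> \<epsilon> * (b - a)"
    proof -
      have "\<bar>\<Sum>K\<in>D. incr W K\<bar> \<le> (\<Sum>K\<in>D. \<bar>incr W K\<bar>)" by (rule sum_abs)
      also have "\<dots> \<le> (\<Sum>K\<in>D. \<epsilon> * (Sup K - Inf K))"
        by (intro sum_mono) (use D(3) in \<open>force simp: incr_Icc\<close>)
      also have "\<dots> = \<epsilon> * measure lebesgue (\<Union>D)"
        by (simp add: measure_Union_division[OF D(1)] sum_distrib_left)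
      also have "\<dots> \<le> \<epsilon> * measure lebesgue {a..b}"
        using e Dab lmeasurable_division[OF D(1)] by (intro mult_left_mono measure_mono_fmeasurable) auto
      finally show ?thesis using assms(2) by simp
    qed
    ultimately show ?thesis using assms(2) by (simp add: incr_Icc algebra_simps)
  qed
  have "\<bar>W b - W a\<bar> \<le> 0"
  proof (rule field_le_epsilon)
    fix e :: real assume "e > 0"
    thus "\<bar>W b - W a\<bar> \<le> 0 + e" using small[of "e / (b - a + 1)"] assms(2) by auto
  qed
  thus ?thesis by simp
qed

section \<open>Almost everywhere differentiability\<close>

text \<open>
  The intervals straddle \<open>x\<close>, which makes this set a countable intersection of open sets, hence
  measurable.
\<close>

definition steep :: "(real \<Rightarrow> real) \<Rightarrow> real \<Rightarrow> real \<Rightarrow> real \<Rightarrow> real set" where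
  "steep F a b q = {x. \<forall>d>0. \<exists>u v. a \<le> u \<and> u < x \<and> x < v \<and> v \<le> b \<and> v - u < d \<and> q * (v - u) < F v - F u}"

lemma steep_subset: "steep F a b q \<subseteq> {a<..<b}"
  unfolding steep_def by (auto dest!: spec[of _ 1])

lemma steep_antimono: "q \<le> q' \<Longrightarrow> steep F a b q' \<subseteq> steep F a b q"
proof
  fix x assume q: "q \<le> q'" and x: "x \<in> steep F a b q'"
  show "x \<in> steep F a b q" unfolding steep_def
  proof (intro CollectI allI impI)
    fix d :: real assume "d > 0"
    then obtain u v where uv: "a \<le> u" "u < x" "x < v" "v \<le> b" "v - u < d" "q' * (v - u) < F v - F u"
      using x unfolding steep_def by blast
    moreover have "q * (v - u) < F v - F u"
    proof -
      have "q * (v - u) \<le> q' * (v - u)" using q uv by (intro mult_right_mono) auto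
      thus ?thesis using uv by linarith
    qed
    ultimately show "\<exists>u v. a \<le> u \<and> u < x \<and> x < v \<and> v \<le> b \<and> v - u < d \<and> q * (v - u) < F v - F u"
      by (intro exI[of _ u] exI[of _ v]) auto
  qed
qed

lemma measure_diff_le_of_approx:
  assumes "A \<in> lmeasurable" "E \<in> lmeasurable" "B \<in> lmeasurable"
  shows "measure lebesgue (A - B) \<le> measure lebesgue (A - E) + measure lebesgue (E - B)"
proof -
  have "measure lebesgue (A - B) \<le> measure lebesgue ((A - E) \<union> (E - B))"
    using assms by (intro measure_mono_fmeasurable) auto
  also have "\<dots> \<le> measure lebesgue (A - E) + measure lebesgue (E - B)"
    using assms by (intro measure_Un_le) auto
  finally show ?thesis .
qed

lemma abs_measure_diff_le:
  assumes A: "A \<in> lmeasurable" and E: "E \<in> lmeasurable"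
  shows "\<bar>measure lebesgue A - measure lebesgue E\<bar> \<le> max (measure lebesgue (A - E)) (measure lebesgue (E - A))"
proof -
  have "measure lebesgue A \<le> measure lebesgue E + measure lebesgue (A - E)" if "A \<in> lmeasurable" "E \<in> lmeasurable" for A E
  proof -
    have "measure lebesgue A \<le> measure lebesgue (E \<union> (A - E))"
      using that by (intro measure_mono_fmeasurable) auto
    also have "\<dots> \<le> measure lebesgue E + measure lebesgue (A - E)"
      using that by (intro measure_Un_le) auto
    finally show ?thesis .
  qed
  from this[OF A E] this[OF E A] show ?thesis by (auto simp: abs_le_iff max_def)
qed

lemma steep_measurable [measurable]: "steep F a b q \<in> sets lebesgue"
proof -
  define G where "G n = \<Union>{{u<..<v} |u v. a \<le> u \<and> v \<le> b \<and> v - u < inverse (Suc n) \<and> q * (v - u) < F v - F u}" for n :: nat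
  have "open (G n)" for n unfolding G_def by (intro open_Union) auto
  hence "(\<Inter>n. G n) \<in> sets lebesgue" by (intro sets.countable_INT'') auto
  moreover have "steep F a b q = (\<Inter>n. G n)"
  proof (intro set_eqI iffI)
    fix x assume "x \<in> steep F a b q"
    have "x \<in> G n" for n
    proof -
      have "inverse (real (Suc n)) > 0" by simp
      then obtain u v where uv: "a \<le> u" "u < x" "x < v" "v \<le> b" "v - u < inverse (Suc n)" "q * (v - u) < F v - F u"
        using \<open>x \<in> steep F a b q\<close> unfolding steep_def by blast
      hence "x \<in> {u<..<v}" by simp
      thus ?thesis unfolding G_def using uv by blast
    qed
    thus "x \<in> (\<Inter>n. G n)" by blast
  next
    fix x assume x: "x \<in> (\<Inter>n. G n)"
    show "x \<in> steep F a b q" unfolding steep_def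
    proof (intro CollectI allI impI)
      fix d :: real assume "d > 0"
      then obtain n where n: "inverse (Suc n) < d" using reals_Archimedean by blast
      have "x \<in> G n" using x by blast
      then obtain u v where uv: "x \<in> {u<..<v}" "a \<le> u" "v \<le> b" "v - u < inverse (Suc n)" "q * (v - u) < F v - F u"
        unfolding G_def by blast
      thus "\<exists>u v. a \<le> u \<and> u < x \<and> x < v \<and> v \<le> b \<and> v - u < d \<and> q * (v - u) < F v - F u"
        using n by (intro exI[of _ u] exI[of _ v]) auto
    qed
  qed
  ultimately show ?thesis by simp
qed

text \<open>An open set barely larger than \<open>E\<close> keeps the excess small, and Vitali's
  theorem inside it keeps the deficit small. \<open>E\<close> is only a subset of the steep set so
  that one and the same \<open>E\<close> can be approximated for several slopes.\<close>

lemma steep_approx: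
  assumes E: "E \<in> lmeasurable" "E \<subseteq> steep F a b q" and "\<eta> > 0"
  obtains D where "D division_of \<Union>D" "\<Union>D \<subseteq> {a..b}"
    "measure lebesgue (E - \<Union>D) < \<eta>" "measure lebesgue (\<Union>D - E) < \<eta>"
    "q * measure lebesgue (\<Union>D) \<le> (\<Sum>K\<in>D. incr F K)"
proof -
  obtain U where U: "open U" "E \<subseteq> U" "U - E \<in> lmeasurable" "emeasure lebesgue (U - E) < ennreal \<eta>"
    using sets_lebesgue_outer_open[OF fmeasurableD[OF E(1)] assms(3)] by blast
  have mU: "measure lebesgue (U - E) < \<eta>"
    using U(3,4) assms(3) by (simp add: emeasure_eq_measure2 ennreal_less_iff)
  obtain D where D: "D division_of \<Union>D" "\<Union>D \<subseteq> U \<inter> {a<..<b}"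
      "\<And>K. K \<in> D \<Longrightarrow> \<exists>u v. u < v \<and> K = {u..v} \<and> q * (v - u) < F v - F u" "measure lebesgue (E - \<Union>D) < \<eta>"
  proof (rule vitali_division[OF E(1) _ _ assms(3)])
    show "open (U \<inter> {a<..<b})" using U(1) by auto
    show "E \<subseteq> U \<inter> {a<..<b}" using U(2) E(2) steep_subset by blast
    fix x d :: real assume "x \<in> E" "d > 0"
    then obtain u v where "u < x" "x < v" "v - u < d" "q * (v - u) < F v - F u"
      using E(2) unfolding steep_def by blast
    thus "\<exists>u v. u < v \<and> u \<le> x \<and> x \<le> v \<and> v - u < d \<and> q * (v - u) < F v - F u"
      by (intro exI[of _ u] exI[of _ v]) auto
  qed blast
  show ?thesis
  proof (rule that[OF D(1) _ D(4)])
    show "\<Union>D \<subseteq> {a..b}" using D(2) by force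
    have "measure lebesgue (\<Union>D - E) \<le> measure lebesgue (U - E)"
      using D(2) U(3) E(1) lmeasurable_division[OF D(1)] by (intro measure_mono_fmeasurable) auto
    thus "measure lebesgue (\<Union>D - E) < \<eta>" using mU by simp
    have "q * measure lebesgue (\<Union>D) = (\<Sum>K\<in>D. q * (Sup K - Inf K))"
      by (simp add: measure_Union_division[OF D(1)] sum_distrib_left)
    also have "\<dots> \<le> (\<Sum>K\<in>D. incr F K)"
      by (intro sum_mono) (use D(3) in \<open>force simp: incr_Icc\<close>)
    finally show "q * measure lebesgue (\<Union>D) \<le> (\<Sum>K\<in>D. incr F K)" .
  qed
qed

text \<open>Replacing \<open>F\<close> by \<open>- F\<close> and \<open>p\<close> by
  \<open>- p\<close> turns slopes below \<open>p\<close> into slopes above \<open>- p\<close>, so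
  the same approximation serves both sides. The two families nearly fill the same set of measure
  \<open>m\<close>, which forces \<open>q * m \<le> p * m\<close> up to a small error.\<close>

lemma negligible_steep_both:
  assumes F: "ac_on a b F" and "p < q"
  shows "negligible (steep F a b q \<inter> steep (\<lambda>x. - F x) a b (- p))" (is "negligible ?E")
proof -
  have E: "?E \<in> lmeasurable"
  proof (rule fmeasurableI2)
    show "{a<..<b} \<in> lmeasurable" by simp
    show "?E \<subseteq> {a<..<b}" using steep_subset by blast
  qed measurable
  define m where "m = measure lebesgue ?E"
  \<comment> \<open>The three terms collect the errors: \<open>\<epsilon>\<close> from comparing the
    two sums of increments, and \<open>\<bar>q\<bar> * \<epsilon>\<close>,
    \<open>\<bar>p\<bar> * \<epsilon>\<close> from replacing the measures of the two unions by
    \<open>m\<close>.\<close>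
  define c where "c = 1 + \<bar>p\<bar> + \<bar>q\<bar>"
  have bound: "(q - p) * m \<le> c * \<epsilon>" if e: "\<epsilon> > 0" for \<epsilon>
  proof -
    obtain \<delta> where \<delta>: "\<delta> > 0" "\<And>A B. \<lbrakk>A division_of \<Union>A; B division_of \<Union>B; \<Union>A \<subseteq> {a..b}; \<Union>B \<subseteq> {a..b};
       measure lebesgue (\<Union>A - \<Union>B) < \<delta>; measure lebesgue (\<Union>B - \<Union>A) < \<delta>\<rbrakk> \<Longrightarrow>
       \<bar>(\<Sum>K\<in>A. incr F K) - (\<Sum>K\<in>B. incr F K)\<bar> < \<epsilon>"
      by (rule ac_on_sum_close[OF F e]) blast
    \<comment> \<open>Half of \<open>\<delta>\<close>, since passing from one union to the other
      through \<open>?E\<close> costs \<open>\<eta>\<close> twice.\<close>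
    define \<eta> where "\<eta> = min \<epsilon> (\<delta> / 2)"
    have \<eta>: "\<eta> > 0" "\<eta> \<le> \<epsilon>" "2 * \<eta> \<le> \<delta>" using e \<delta>(1) by (auto simp: \<eta>_def)
    obtain A where A: "A division_of \<Union>A" "\<Union>A \<subseteq> {a..b}"
      "measure lebesgue (?E - \<Union>A) < \<eta>" "measure lebesgue (\<Union>A - ?E) < \<eta>"
      "q * measure lebesgue (\<Union>A) \<le> (\<Sum>K\<in>A. incr F K)"
      by (rule steep_approx[OF E Int_lower1 \<eta>(1)]) blast
    obtain B where B: "B division_of \<Union>B" "\<Union>B \<subseteq> {a..b}"
      "measure lebesgue (?E - \<Union>B) < \<eta>" "measure lebesgue (\<Union>B - ?E) < \<eta>"
      "- p * measure lebesgue (\<Union>B) \<le> (\<Sum>K\<in>B. incr (\<lambda>x. - F x) K)"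
      by (rule steep_approx[OF E Int_lower2 \<eta>(1)]) blast
    note mA = lmeasurable_division[OF A(1)] and mB = lmeasurable_division[OF B(1)]
    have "\<bar>(\<Sum>K\<in>A. incr F K) - (\<Sum>K\<in>B. incr F K)\<bar> < \<epsilon>"
      using measure_diff_le_of_approx[OF mA E mB] measure_diff_le_of_approx[OF mB E mA] A B \<eta>
      by (intro \<delta>(2)) linarith+
    moreover have "(\<Sum>K\<in>B. incr (\<lambda>x. - F x) K) = - (\<Sum>K\<in>B. incr F K)"
      by (simp add: incr_def flip: sum_negf)
    hence "(\<Sum>K\<in>B. incr F K) \<le> p * measure lebesgue (\<Union>B)"
      using B(5) by simp
    ultimately have "q * measure lebesgue (\<Union>A) \<le> p * measure lebesgue (\<Union>B) + \<epsilon>" using A(5) by linarith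
    moreover have "\<bar>q * (measure lebesgue (\<Union>A) - m)\<bar> \<le> \<bar>q\<bar> * \<epsilon>"
      unfolding abs_mult m_def using abs_measure_diff_le[OF mA E] A \<eta> by (intro mult_left_mono) auto
    moreover have "\<bar>p * (measure lebesgue (\<Union>B) - m)\<bar> \<le> \<bar>p\<bar> * \<epsilon>"
      unfolding abs_mult m_def using abs_measure_diff_le[OF mB E] B \<eta> by (intro mult_left_mono) auto
    ultimately show ?thesis unfolding c_def by (simp add: algebra_simps abs_le_iff)
  qed
  have c: "c > 0" unfolding c_def by simp
  have "(q - p) * m \<le> 0"
  proof (rule field_le_epsilon)
    fix e :: real assume "e > 0"
    thus "(q - p) * m \<le> 0 + e" using bound[of "e / c"] c by simp
  qed
  hence "m = 0" using assms(2) by (simp add: m_def mult_le_0_iff order_antisym)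
  thus ?thesis using E by (simp add: m_def negligible_iff_measure)
qed

text \<open>If the set had positive measure \<open>m\<close>, families of slope at least
  \<open>n\<close> approximating it would have increments of at least \<open>n * (m / 2)\<close>,
  while absolute continuity keeps all these sums within distance 1 of the one for
  \<open>n = 0\<close>.\<close>

lemma negligible_steep_Inter:
  assumes F: "ac_on a b F"
  shows "negligible (\<Inter>n::nat. steep F a b (real n))" (is "negligible ?E")
proof -
  have E: "?E \<in> lmeasurable"
  proof (rule fmeasurableI2)
    show "{a<..<b} \<in> lmeasurable" by simp
    show "?E \<subseteq> {a<..<b}" using steep_subset by blast
  qed measurable
  define m where "m = measure lebesgue ?E"
  have "m = 0"
  proof (rule ccontr)
    assume "m \<noteq> 0"
    hence m: "m > 0" by (simp add: m_def zero_less_measure_iff)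
    obtain \<delta> where \<delta>: "\<delta> > 0" "\<And>A B. \<lbrakk>A division_of \<Union>A; B division_of \<Union>B; \<Union>A \<subseteq> {a..b}; \<Union>B \<subseteq> {a..b};
       measure lebesgue (\<Union>A - \<Union>B) < \<delta>; measure lebesgue (\<Union>B - \<Union>A) < \<delta>\<rbrakk> \<Longrightarrow>
       \<bar>(\<Sum>K\<in>A. incr F K) - (\<Sum>K\<in>B. incr F K)\<bar> < 1"
      by (rule ac_on_sum_close[OF F, of 1]) auto
    \<comment> \<open>The bound \<open>m / 2\<close> ensures that every approximating union still
      has measure at least \<open>m / 2\<close>.\<close>
    define \<eta> where "\<eta> = min (m / 2) (\<delta> / 2)"
    have \<eta>: "\<eta> > 0" "2 * \<eta> \<le> m" "2 * \<eta> \<le> \<delta>" using m \<delta>(1) by (auto simp: \<eta>_def)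
    have "\<exists>D. D division_of \<Union>D \<and> \<Union>D \<subseteq> {a..b} \<and> measure lebesgue (?E - \<Union>D) < \<eta> \<and>
      measure lebesgue (\<Union>D - ?E) < \<eta> \<and> real n * measure lebesgue (\<Union>D) \<le> (\<Sum>K\<in>D. incr F K)" for n
      by (rule steep_approx[OF E INT_lower \<eta>(1), of n]) auto
    then obtain D where D: "\<And>n. D n division_of \<Union>(D n)" "\<And>n. \<Union>(D n) \<subseteq> {a..b}"
      "\<And>n. measure lebesgue (?E - \<Union>(D n)) < \<eta>" "\<And>n. measure lebesgue (\<Union>(D n) - ?E) < \<eta>"
      "\<And>n. real n * measure lebesgue (\<Union>(D n)) \<le> (\<Sum>K\<in>D n. incr F K)" by metis
    note mD = lmeasurable_division[OF D(1)]
    have b: "real n * (m / 2) \<le> (\<Sum>K\<in>D 0. incr F K) + 1" for n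
    proof -
      have "m / 2 \<le> measure lebesgue (\<Union>(D n))"
        using abs_measure_diff_le[OF mD E, of n] D(3,4)[of n] \<eta> unfolding m_def by linarith
      hence "real n * (m / 2) \<le> real n * measure lebesgue (\<Union>(D n))" by (intro mult_left_mono) auto
      also have "\<dots> \<le> (\<Sum>K\<in>D n. incr F K)" by (rule D)
      also have "\<bar>(\<Sum>K\<in>D n. incr F K) - (\<Sum>K\<in>D 0. incr F K)\<bar> < 1"
        using measure_diff_le_of_approx[OF mD E mD, of n 0] measure_diff_le_of_approx[OF mD E mD, of 0 n]
           D(3,4)[of n] D(3,4)[of 0] \<eta>
        by (intro \<delta>(2)[OF D(1) D(1) D(2) D(2)]) linarith+
      hence "(\<Sum>K\<in>D n. incr F K) \<le> (\<Sum>K\<in>D 0. incr F K) + 1" by linarith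
      finally show ?thesis .
    qed
    obtain n where "((\<Sum>K\<in>D 0. incr F K) + 1) / (m / 2) < real n" using reals_Archimedean2 by blast
    thus False using b[of n] m by (simp add: field_simps)
  qed
  thus ?thesis using E by (simp add: m_def negligible_iff_measure)
qed

text \<open>Not being steep for \<open>F\<close> or \<open>- F\<close> bounds the slopes over short
  intervals around \<open>x\<close>, and the absence of a rational gap makes the upper and lower
  limits of these slopes agree. Rational \<open>p\<close> and \<open>q\<close> suffice and keep the
  exceptional set a countable union.\<close>

lemma differentiable_of_not_steep:
  assumes x: "a < x" "x < b" and cont: "isCont F x"
    and fin: "x \<notin> steep F a b M" "x \<notin> steep (\<lambda>x. - F x) a b M"
    and osc: "\<And>p q. p \<in> \<rat> \<Longrightarrow> q \<in> \<rat> \<Longrightarrow> p < q \<Longrightarrow> x \<notin> steep F a b q \<inter> steep (\<lambda>x. - F x) a b (- p)"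
  shows "\<exists>D. (F has_real_derivative D) (at x)"
proof -
  define near where "near d u v \<longleftrightarrow> a \<le> u \<and> u < x \<and> x < v \<and> v \<le> b \<and> v - u < d" for d u v
  have near_ex: "\<exists>u v. near d u v" if "d > 0" for d
  proof -
    obtain u where u: "max a (x - d / 2) < u" "u < x" using dense[of "max a (x - d / 2)" x] x \<open>d > 0\<close> by auto
    obtain v where v: "x < v" "v < min b (x + d / 2)" using dense[of x "min b (x + d / 2)"] x \<open>d > 0\<close> by auto
    have "near d u v" unfolding near_def using u v by simp
    thus ?thesis by blast
  qed
  have upper: "x \<notin> steep F a b q \<longleftrightarrow> (\<exists>d>0. \<forall>u v. near d u v \<longrightarrow> F v - F u \<le> q * (v - u))" for q
  proof -
    have "x \<in> steep F a b q \<longleftrightarrow> (\<forall>d>0. \<exists>u v. near d u v \<and> q * (v - u) < F v - F u)"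
      by (simp add: steep_def near_def conj_assoc)
    thus ?thesis by (meson not_less)
  qed
  have lower: "x \<notin> steep (\<lambda>x. - F x) a b (- p) \<longleftrightarrow> (\<exists>d>0. \<forall>u v. near d u v \<longrightarrow> p * (v - u) \<le> F v - F u)" for p
  proof -
    have "- p * (v - u) < - F v - - F u \<longleftrightarrow> F v - F u < p * (v - u)" for u v by (simp add: algebra_simps)
    hence "x \<in> steep (\<lambda>x. - F x) a b (- p) \<longleftrightarrow> (\<forall>d>0. \<exists>u v. near d u v \<and> F v - F u < p * (v - u))"
      by (simp add: steep_def near_def conj_assoc)
    thus ?thesis by (meson not_less)
  qed
  \<comment> \<open>The eventual lower bounds for slopes of intervals around \<open>x\<close>; the
    supremum is the candidate for the derivative.\<close>
  define lb where "lb = {p. x \<notin> steep (\<lambda>x. - F x) a b (- p)}"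
  have le: "p \<le> q" if p: "p \<in> lb" and q: "x \<notin> steep F a b q" for p q
  proof -
    obtain d1 d2 where d: "d1 > 0" "d2 > 0" "\<And>u v. near d1 u v \<Longrightarrow> p * (v - u) \<le> F v - F u"
      "\<And>u v. near d2 u v \<Longrightarrow> F v - F u \<le> q * (v - u)"
      using p q unfolding lb_def upper mem_Collect_eq lower by blast
    obtain u v where uv: "near (min d1 d2) u v" using near_ex d by (metis min_less_iff_conj)
    hence "near d1 u v" "near d2 u v" "u < v" unfolding near_def by auto
    hence "p * (v - u) \<le> q * (v - u)" using d(3,4) order_trans by blast
    thus ?thesis using \<open>u < v\<close> by simp
  qed
  have "- M \<in> lb" using fin(2) by (simp add: lb_def)
  hence lb: "lb \<noteq> {}" "bdd_above lb" using le[OF _ fin(1)] by (auto simp: bdd_above_def)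
  define D where "D = Sup lb"
  have straddle: "\<exists>d>0. \<forall>u v. near d u v \<longrightarrow> \<bar>F v - F u - D * (v - u)\<bar> \<le> e * (v - u)" if e: "e > 0" for e
  proof -
    \<comment> \<open>Two rationals just above \<open>D\<close> are needed: \<open>p\<close> is no
      longer a lower bound, so slopes below \<open>p\<close> occur at every scale, and then the gap
      condition makes \<open>q\<close> an eventual upper bound.\<close>
    obtain p where p: "p \<in> \<rat>" "D < p" "p < D + e" using Rats_dense_in_real[of D "D + e"] e by auto
    obtain q where q: "q \<in> \<rat>" "p < q" "q < D + e" using Rats_dense_in_real[OF p(3)] by auto
    have "p \<notin> lb" using p(2) cSup_upper[OF _ lb(2), of p] unfolding D_def by auto
    hence "x \<notin> steep F a b q" using osc[OF p(1) q(1,2)] unfolding lb_def by auto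
    then obtain d2 where d2: "d2 > 0" "\<And>u v. near d2 u v \<Longrightarrow> F v - F u \<le> q * (v - u)"
      unfolding upper by blast
    obtain r where r: "r \<in> lb" "D - e < r"
      using less_cSupD[OF lb(1), of "D - e"] e unfolding D_def by auto
    then obtain d1 where d1: "d1 > 0" "\<And>u v. near d1 u v \<Longrightarrow> r * (v - u) \<le> F v - F u"
      unfolding lb_def mem_Collect_eq lower by blast
    have "\<bar>F v - F u - D * (v - u)\<bar> \<le> e * (v - u)" if uv: "near (min d1 d2) u v" for u v
    proof -
      have n: "near d1 u v" "near d2 u v" "u < v" using uv unfolding near_def by auto
      have "F v - F u \<le> (D + e) * (v - u)"
      proof -
        have "q * (v - u) \<le> (D + e) * (v - u)" using q(3) n(3) by (intro mult_right_mono) auto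
        thus ?thesis using d2(2)[OF n(2)] by linarith
      qed
      moreover have "(D - e) * (v - u) \<le> F v - F u"
      proof -
        have "(D - e) * (v - u) \<le> r * (v - u)" using r(2) n(3) by (intro mult_right_mono) auto
        thus ?thesis using d1(2)[OF n(1)] by linarith
      qed
      ultimately show ?thesis by (simp add: algebra_simps abs_le_iff)
    qed
    thus ?thesis using d1(1) d2(1) by (intro exI[of _ "min d1 d2"]) auto
  qed
  have "(F has_derivative (\<lambda>h. D * h)) (at x)"
    unfolding has_derivative_at_alt
  proof (intro conjI allI impI)
    show "bounded_linear (\<lambda>h. D * h)" by (rule bounded_linear_mult_right)
    fix e :: real assume "e > 0"
    then obtain d where d: "d > 0" "\<And>u v. near d u v \<Longrightarrow> \<bar>F v - F u - D * (v - u)\<bar> \<le> e * (v - u)"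
      using straddle by blast
    let ?d = "min d (min (x - a) (b - x))"
    \<comment> \<open>Slopes are controlled only for intervals with \<open>x\<close> strictly
      inside. Continuity permits moving one endpoint to \<open>x\<close>, which yields the
      difference quotients at \<open>x\<close>.\<close>
    have cF: "(F \<longlongrightarrow> F x) (at_left x)" "(F \<longlongrightarrow> F x) (at_right x)"
      using cont unfolding isCont_def by (simp_all add: filterlim_at_split)
    have "\<bar>F y - F x - D * (y - x)\<bar> \<le> e * \<bar>y - x\<bar>" if y: "\<bar>y - x\<bar> < ?d" for y
    proof -
      consider "y > x" | "y = x" | "y < x" by linarith
      thus ?thesis
      proof cases
        case 1
        have "\<bar>F y - F x - D * (y - x)\<bar> \<le> e * (y - x)"
        proof (rule tendsto_le)
          show "((\<lambda>u. e * (y - u)) \<longlongrightarrow> e * (y - x)) (at_left x)" by (intro tendsto_intros)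
          show "((\<lambda>u. \<bar>F y - F u - D * (y - u)\<bar>) \<longlongrightarrow> \<bar>F y - F x - D * (y - x)\<bar>) (at_left x)"
            by (intro tendsto_intros cF)
          have "eventually (\<lambda>u. u \<in> {max a (y - d)<..<x}) (at_left x)"
            using x y 1 by (intro eventually_at_leftI[of "max a (y - d)"]) auto
          thus "eventually (\<lambda>u. \<bar>F y - F u - D * (y - u)\<bar> \<le> e * (y - u)) (at_left x)"
            by eventually_elim (use x y 1 in \<open>auto intro!: d(2) simp: near_def\<close>)
        qed simp
        thus ?thesis using 1 by simp
      next
        case 2
        thus ?thesis by simp
      next
        case 3
        have "\<bar>F x - F y - D * (x - y)\<bar> \<le> e * (x - y)"
        proof (rule tendsto_le)
          show "((\<lambda>v. e * (v - y)) \<longlongrightarrow> e * (x - y)) (at_right x)" by (intro tendsto_intros)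
          show "((\<lambda>v. \<bar>F v - F y - D * (v - y)\<bar>) \<longlongrightarrow> \<bar>F x - F y - D * (x - y)\<bar>) (at_right x)"
            by (intro tendsto_intros cF)
          have "eventually (\<lambda>v. v \<in> {x<..<min b (y + d)}) (at_right x)"
            using x y 3 by (intro eventually_at_rightI[of _ "min b (y + d)"]) auto
          thus "eventually (\<lambda>v. \<bar>F v - F y - D * (v - y)\<bar> \<le> e * (v - y)) (at_right x)"
            by eventually_elim (use x y 3 in \<open>auto intro!: d(2) simp: near_def\<close>)
        qed simp
        thus ?thesis using 3 by (simp add: abs_le_iff algebra_simps)
      qed
    qed
    thus "\<exists>d>0. \<forall>y. norm (y - x) < d \<longrightarrow> norm (F y - F x - D * (y - x)) \<le> e * norm (y - x)"
      using x d(1) by (intro exI[of _ ?d]) auto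
  qed
  thus ?thesis by (auto simp: has_field_derivative_def)
qed

theorem ac_on_differentiable_ae:
  assumes F: "ac_on a b F"
  shows "negligible {x \<in> {a<..<b}. \<nexists>D. (F has_real_derivative D) (at x)}"
proof -
  let ?G = "\<lambda>x. - F x"
  let ?I = "\<lambda>F. \<Inter>n::nat. steep F a b (real n)"
  let ?P = "{(p, q). p \<in> \<rat> \<and> q \<in> \<rat> \<and> p < q}"
  let ?O = "\<Union>(p, q)\<in>?P. steep F a b q \<inter> steep ?G a b (- p)"
  have "countable ?P"
    by (rule countable_subset[of _ "\<rat> \<times> \<rat>"]) (auto simp: countable_rat)
  hence "negligible ?O"
    by (intro negligible_countable_Union) (auto intro!: negligible_steep_both[OF F])
  hence "negligible (?I F \<union> ?I ?G \<union> ?O)"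
    using negligible_steep_Inter[OF F] negligible_steep_Inter[OF ac_on_uminus[OF F]] by auto
  moreover have "{x \<in> {a<..<b}. \<nexists>D. (F has_real_derivative D) (at x)} \<subseteq> ?I F \<union> ?I ?G \<union> ?O"
  proof
    fix x assume x: "x \<in> {x \<in> {a<..<b}. \<nexists>D. (F has_real_derivative D) (at x)}"
    show "x \<in> ?I F \<union> ?I ?G \<union> ?O"
    proof (rule ccontr)
      assume n: "x \<notin> ?I F \<union> ?I ?G \<union> ?O"
      then obtain i j where ij: "x \<notin> steep F a b (real i)" "x \<notin> steep ?G a b (real j)" by auto
      \<comment> \<open>The two slope bounds come with different indices, whereas a common one is
        wanted.\<close>
      have mono: "x \<notin> steep H a b (real (max i j))" if h: "x \<notin> steep H a b (real k)" "k \<le> max i j" for H k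
        using h steep_antimono[of "real k" "real (max i j)" H a b] by auto
      have "\<exists>D. (F has_real_derivative D) (at x)"
      proof (rule differentiable_of_not_steep[OF _ _ _ mono[OF ij(1)] mono[OF ij(2)]])
        show "isCont F x" using x by (intro ac_on_isCont[OF F]) auto
      qed (use x n in auto)
      thus False using x by blast
    qed
  qed
  ultimately show ?thesis by (rule negligible_subset)
qed

text \<open>Transfers the definition by indexed families to divisions by enumerating a division:
  disjoint interiors of closed intervals are exactly disjointness of the open ones. The function
  \<open>\<phi>\<close> stands for the real or imaginary part of \<open>g\<close>.\<close>

lemma ac_on_of_abs_continuous:
  assumes g: "abs_continuous_on_interval a b g" and \<phi>: "\<And>x y. \<bar>\<phi> y - \<phi> x\<bar> \<le> norm (g y - g x)"
  shows "ac_on a b \<phi>"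
  unfolding ac_on_def
proof (intro allI impI)
  fix \<epsilon> :: real assume "\<epsilon> > 0"
  then obtain \<delta> where \<delta>: "\<delta> > 0" "\<And>(n::nat) x y. \<lbrakk>\<forall>i<n. a \<le> x i \<and> x i \<le> y i \<and> y i \<le> b;
      disjoint_family_on (\<lambda>i. {x i<..<y i}) {..<n}; (\<Sum>i<n. y i - x i) < \<delta>\<rbrakk> \<Longrightarrow> (\<Sum>i<n. norm (g (y i) - g (x i))) < \<epsilon>"
    using g unfolding abs_continuous_on_interval_def by meson
  have "(\<Sum>K\<in>D. \<bar>incr \<phi> K\<bar>) < \<epsilon>"
    if D: "D division_of \<Union>D" "\<Union>D \<subseteq> {a..b}" "measure lebesgue (\<Union>D) < \<delta>" for D
  proof -
    obtain h where h: "bij_betw h {0..<card D} D"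
      using ex_bij_betw_nat_finite division_ofD(1)[OF D(1)] by blast
    hence h: "bij_betw h {..<card D} D" by (simp add: atLeast0LessThan)
    have K: "\<exists>u v. u \<le> v \<and> h i = {u..v} \<and> a \<le> u \<and> v \<le> b" if i: "i < card D" for i
    proof -
      have hi: "h i \<in> D" using h i by (auto simp: bij_betw_def)
      then obtain u v where uv: "u \<le> v" "h i = {u..v}" using division_Icc[OF D(1)] by blast
      hence "{u..v} \<subseteq> {a..b}" using D(2) hi by blast
      thus ?thesis using uv by auto
    qed
    have "(\<Sum>i<card D. norm (g (Sup (h i)) - g (Inf (h i)))) < \<epsilon>"
    proof (rule \<delta>(2))
      show "\<forall>i<card D. a \<le> Inf (h i) \<and> Inf (h i) \<le> Sup (h i) \<and> Sup (h i) \<le> b"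
        using K by force
      show "disjoint_family_on (\<lambda>i. {Inf (h i)<..<Sup (h i)}) {..<card D}"
        unfolding disjoint_family_on_def
      proof (intro ballI impI)
        fix i j assume ij: "i \<in> {..<card D}" "j \<in> {..<card D}" "i \<noteq> j"
        have "h i \<in> D" "h j \<in> D" "h i \<noteq> h j" using h ij by (auto simp: bij_betw_def inj_on_def)
        hence "interior (h i) \<inter> interior (h j) = {}" by (rule division_ofD(5)[OF D(1)])
        moreover have "interior (h k) = {Inf (h k)<..<Sup (h k)}" if "k < card D" for k
          using K[OF that] by force
        ultimately show "{Inf (h i)<..<Sup (h i)} \<inter> {Inf (h j)<..<Sup (h j)} = {}" using ij by simp
      qed
      have "(\<Sum>i<card D. Sup (h i) - Inf (h i)) = (\<Sum>K\<in>D. Sup K - Inf K)"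
        by (rule sum.reindex_bij_betw[OF h])
      thus "(\<Sum>i<card D. Sup (h i) - Inf (h i)) < \<delta>"
        using D(3) measure_Union_division[OF D(1)] by simp
    qed
    also have "(\<Sum>i<card D. norm (g (Sup (h i)) - g (Inf (h i)))) = (\<Sum>K\<in>D. norm (g (Sup K) - g (Inf K)))"
      by (rule sum.reindex_bij_betw[OF h])
    finally have "(\<Sum>K\<in>D. norm (g (Sup K) - g (Inf K))) < \<epsilon>" .
    moreover have "(\<Sum>K\<in>D. \<bar>incr \<phi> K\<bar>) \<le> (\<Sum>K\<in>D. norm (g (Sup K) - g (Inf K)))"
      unfolding incr_def by (intro sum_mono \<phi>)
    ultimately show ?thesis by linarith
  qed
  thus "\<exists>\<delta>>0. \<forall>D. D division_of \<Union>D \<longrightarrow> \<Union>D \<subseteq> {a..b} \<longrightarrow>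
     measure lebesgue (\<Union>D) < \<delta> \<longrightarrow> (\<Sum>K\<in>D. \<bar>incr \<phi> K\<bar>) < \<epsilon>"
    using \<delta>(1) by blast
qed

section \<open>From the almost everywhere equation to a differential equation\<close>

lemma deriv_on_eqI:
  assumes "(\<phi> has_vector_derivative D) (at x within {0..l})" "x \<in> {0..l}" "0 < l"
  shows "deriv_on l \<phi> x = D"
proof -
  have "vector_derivative \<phi> (at x within cbox 0 l) = D"
    by (rule vector_derivative_within_cbox) (use assms in auto)
  thus ?thesis by (simp add: deriv_on_def)
qed

lemma has_vector_derivative_zero_eq:
  fixes f :: "real \<Rightarrow> 'a::real_normed_vector"
  assumes "\<And>x. x \<in> {0..l} \<Longrightarrow> (f has_vector_derivative 0) (at x within {0..l})" "x \<in> {0..l}"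
  shows "f x = f 0"
proof (rule has_derivative_zero_unique[of "{0..l}" f x 0])
  show "(f has_derivative (\<lambda>h. 0)) (at x within {0..l})" if "x \<in> {0..l}" for x
    using assms(1)[OF that] by (simp add: has_vector_derivative_def)
qed (use assms(2) in auto)

text \<open>With \<open>H\<close> the primitive of \<open>h\<close>, the difference
  \<open>g - H\<close> is absolutely continuous with derivative zero almost everywhere, hence
  constant. So \<open>g\<close> inherits from \<open>H\<close> the derivative \<open>h\<close> at
  every point, one-sided at the ends.\<close>

lemma abs_continuous_deriv_on_ae:
  fixes g h :: "real \<Rightarrow> complex"
  assumes g: "abs_continuous_on_interval 0 l g" and l: "0 < l" and h: "continuous_on {0..l} h"
    and ae: "AE x in lebesgue_on {0..l}. deriv_on l g x = h x" and x: "x \<in> {0..l}"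
  shows "(g has_vector_derivative h x) (at x within {0..l})"
proof -
  have "AE x in lebesgue. x \<in> {0..l} \<longrightarrow> deriv_on l g x = h x"
    using ae by (subst (asm) AE_restrict_space_iff) auto
  then obtain N0 where N0: "\<And>x. x \<notin> N0 \<Longrightarrow> x \<in> {0..l} \<longrightarrow> deriv_on l g x = h x" "N0 \<in> null_sets lebesgue"
    by (rule AE_E3) auto
  define H where "H = (\<lambda>x. integral {0..x} h)"
  have H: "(H has_vector_derivative h x) (at x within {0..l})" if "x \<in> {0..l}" for x
    using integral_has_vector_derivative[OF h that] by (simp add: H_def)
  obtain C where C: "\<And>x. x \<in> {0..l} \<Longrightarrow> norm (h x) \<le> C"
    using compact_continuous_image[OF h compact_Icc] compact_imp_bounded
    by (metis bounded_iff image_eqI)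
  have lip: "norm (H y - H x) \<le> C * (y - x)" if "0 \<le> x" "x \<le> y" "y \<le> l" for x y
  proof -
    have sub: "{0..y} \<subseteq> {0..l}" "{x..y} \<subseteq> {0..l}" using that by auto
    have "H x + integral {x..y} h = H y" unfolding H_def
      using that continuous_on_subset[OF h sub(1)]
      by (intro Henstock_Kurzweil_Integration.integral_combine integrable_continuous_real) auto
    hence "H y - H x = integral {x..y} h" by (metis add_diff_cancel_left')
    also have "norm \<dots> \<le> C * (y - x)"
      using that continuous_on_subset[OF h sub(2)] C sub(2) by (intro integral_bound) auto
    finally show ?thesis .
  qed
  define nd where "nd F = {x \<in> {0<..<l}. \<nexists>D. (F has_real_derivative D) (at x)}" for F :: "real \<Rightarrow> real"
  let ?Re = "\<lambda>x. Re (g x)" and ?Im = "\<lambda>x. Im (g x)"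
  have acg: "ac_on 0 l ?Re" "ac_on 0 l ?Im"
    by (rule ac_on_of_abs_continuous[OF g]; metis abs_Re_le_cmod abs_Im_le_cmod minus_complex.sel)+
  \<comment> \<open>Agreement of \<open>deriv_on l g\<close> with \<open>h\<close> says nothing at a
    point where \<open>g\<close> has no derivative; such points must be removed as well.\<close>
  define N where "N = N0 \<union> nd ?Re \<union> nd ?Im"
  have N: "negligible N"
    unfolding N_def nd_def
    using ac_on_differentiable_ae[OF acg(1)] ac_on_differentiable_ae[OF acg(2)] N0(2)
    by (intro negligible_Un) (simp_all add: negligible_iff_null_sets)
  have der: "(g has_vector_derivative h y) (at y)" if y: "y \<in> {0<..<l} - N" for y
  proof -
    obtain D1 D2 where "(?Re has_real_derivative D1) (at y)" "(?Im has_real_derivative D2) (at y)"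
      using y unfolding N_def nd_def by blast
    hence D: "(g has_vector_derivative Complex D1 D2) (at y)"
      by (simp add: has_vector_derivative_complex_iff)
    have "deriv_on l g y = Complex D1 D2"
      using y l by (intro deriv_on_eqI[OF has_vector_derivative_at_within[OF D]]) auto
    thus ?thesis using D N0(1)[of y] y by (simp add: N_def)
  qed
  have Hd: "(H has_vector_derivative h y) (at y)" if "y \<in> {0<..<l}" for y
    using H[of y] that by (simp add: at_within_Icc_at)
  \<comment> \<open>The constancy argument is for real functions and is used for the real and the
    imaginary part.\<close>
  have eq: "\<phi> (g y - H y) = \<phi> (g 0 - H 0)"
    if y: "y \<in> {0..l}" and ac: "ac_on 0 l (\<lambda>x. \<phi> (g x))" and \<phi>: "bounded_linear \<phi>" "\<And>z. \<bar>\<phi> z\<bar> \<le> norm z"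
    for y and \<phi> :: "complex \<Rightarrow> real"
  proof -
    interpret bounded_linear \<phi> by fact
    have "ac_on 0 l (\<lambda>x. \<phi> (H x))"
    proof (rule ac_on_lipschitz[of _ _ _ C])
      fix x y assume xy: "0 \<le> x" "x \<le> y" "y \<le> l"
      have "\<bar>\<phi> (H y) - \<phi> (H x)\<bar> \<le> norm (H y - H x)" using \<phi>(2)[of "H y - H x"] by (simp add: diff)
      thus "\<bar>\<phi> (H y) - \<phi> (H x)\<bar> \<le> C * (y - x)" using lip[OF xy] by linarith
    qed
    hence "ac_on 0 l (\<lambda>x. \<phi> (g x) - \<phi> (H x))" by (rule ac_on_diff[OF ac])
    hence "ac_on 0 y (\<lambda>x. \<phi> (g x) - \<phi> (H x))" using y by (auto intro: ac_on_subinterval)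
    hence "\<phi> (g y) - \<phi> (H y) = \<phi> (g 0) - \<phi> (H 0)"
    proof (rule ac_on_constant[OF _ _ N])
      fix x assume x: "x \<in> {0<..<y} - N"
      hence "((\<lambda>x. g x - H x) has_vector_derivative h x - h x) (at x)"
        using y by (intro has_vector_derivative_diff der Hd) auto
      hence "((\<lambda>x. \<phi> (g x - H x)) has_vector_derivative \<phi> 0) (at x)"
        using has_vector_derivative[of "\<lambda>x. g x - H x" 0 "at x"] by simp
      thus "((\<lambda>x. \<phi> (g x) - \<phi> (H x)) has_real_derivative 0) (at x)"
        by (simp add: diff zero has_real_derivative_iff_has_vector_derivative)
    qed (use y in auto)
    thus ?thesis by (simp add: diff)
  qed
  have gH: "g y = g 0 - H 0 + H y" if "y \<in> {0..l}" for y
    using eq[OF that acg(1) bounded_linear_Re abs_Re_le_cmod]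
      eq[OF that acg(2) bounded_linear_Im abs_Im_le_cmod] by (simp add: complex_eq_iff)
  have "((\<lambda>y. g 0 - H 0 + H y) has_vector_derivative 0 + h x) (at x within {0..l})"
    by (intro has_vector_derivative_add has_vector_derivative_const H x)
  hence "((\<lambda>y. g 0 - H 0 + H y) has_vector_derivative h x) (at x within {0..l})" by simp
  thus ?thesis by (rule has_vector_derivative_transform_within[OF _ zero_less_one x]) (rule gH[symmetric])
qed

text \<open>Factoring the second-order equation: \<open>u = \<psi> + \<i> * w * \<phi>\<close>
  satisfies \<open>u' = \<i> * w * u\<close>, so its product with
  \<open>exp (- \<i> * w * x)\<close> is constant.\<close>

lemma first_order_form:
  fixes \<phi> \<psi> :: "real \<Rightarrow> complex" and w :: complex
  assumes \<phi>: "\<And>x. x \<in> {0..l} \<Longrightarrow> (\<phi> has_vector_derivative \<psi> x) (at x within {0..l})"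
    and \<psi>: "\<And>x. x \<in> {0..l} \<Longrightarrow> (\<psi> has_vector_derivative - (w\<^sup>2) * \<phi> x) (at x within {0..l})"
    and x: "x \<in> {0..l}"
  shows "\<psi> x + \<i> * w * \<phi> x = exp (\<i> * w * x) * (\<psi> 0 + \<i> * w * \<phi> 0)"
proof -
  define u where "u x = \<psi> x + \<i> * w * \<phi> x" for x
  define E where "E x = exp (- (\<i> * w) * of_real x)" for x :: real
  have E: "(E has_vector_derivative - (\<i> * w) * E y) (at y within {0..l})" for y
    unfolding E_def by (rule has_vector_derivative_real_field) (auto intro!: derivative_eq_intros)
  have "((\<lambda>x. u x * E x) has_vector_derivative 0) (at y within {0..l})" if y: "y \<in> {0..l}" for y
  proof -
    have "(u has_vector_derivative - (w\<^sup>2) * \<phi> y + \<i> * w * \<psi> y) (at y within {0..l})"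
      unfolding u_def by (intro has_vector_derivative_add \<psi>[OF y] has_vector_derivative_mult_right \<phi>[OF y])
    from has_vector_derivative_mult[OF this E[of y]] show ?thesis
      by (simp add: u_def algebra_simps power2_eq_square)
  qed
  from has_vector_derivative_zero_eq[of l "\<lambda>x. u x * E x", OF this x]
  have "u x * E x = u 0" by (simp add: E_def)
  moreover have "E x * exp (\<i> * w * x) = 1" by (simp add: E_def exp_minus_inverse flip: exp_add)
  ultimately have "u x = exp (\<i> * w * x) * u 0" by (metis mult.assoc mult.commute mult_1)
  thus ?thesis by (simp add: u_def)
qed

section \<open>Membership in the maximal domain, and regularity of eigenfunctions\<close>

lemma C1_lipschitz:
  fixes \<phi> \<psi> :: "real \<Rightarrow> complex"
  assumes d: "\<And>x. x \<in> {0..l} \<Longrightarrow> (\<phi> has_vector_derivative \<psi> x) (at x within {0..l})"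
    and c: "continuous_on {0..l} \<psi>"
  obtains C where "\<And>x y. x \<in> {0..l} \<Longrightarrow> y \<in> {0..l} \<Longrightarrow> norm (\<phi> y - \<phi> x) \<le> C * \<bar>y - x\<bar>" "0 \<le> C"
proof -
  obtain C where C: "\<And>x. x \<in> {0..l} \<Longrightarrow> norm (\<psi> x) \<le> C"
    using compact_continuous_image[OF c compact_Icc] compact_imp_bounded
    by (metis bounded_iff image_eqI)
  have "norm (\<phi> y - \<phi> x) \<le> \<bar>C\<bar> * norm (y - x)" if "x \<in> {0..l}" "y \<in> {0..l}" for x y
  proof (rule differentiable_bound[of "{0..l}"])
    show "(\<phi> has_derivative (\<lambda>h. h *\<^sub>R \<psi> z)) (at z within {0..l})" if "z \<in> {0..l}" for z
      using d[OF that] by (simp add: has_vector_derivative_def)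
    show "onorm (\<lambda>h. h *\<^sub>R \<psi> z) \<le> \<bar>C\<bar>" if "z \<in> {0..l}" for z
    proof (intro onorm_le)
      fix x :: real
      have "norm (\<psi> z) \<le> \<bar>C\<bar>" using C[OF that] by linarith
      hence "\<bar>x\<bar> * norm (\<psi> z) \<le> \<bar>x\<bar> * \<bar>C\<bar>" by (rule mult_left_mono) simp
      thus "norm (x *\<^sub>R \<psi> z) \<le> \<bar>C\<bar> * norm x" by (simp add: mult.commute)
    qed
  qed (use that in auto)
  thus ?thesis by (intro that[of "\<bar>C\<bar>"]) auto
qed

lemma C1_abs_continuous:
  fixes \<phi> \<psi> :: "real \<Rightarrow> complex"
  assumes "\<And>x. x \<in> {0..l} \<Longrightarrow> (\<phi> has_vector_derivative \<psi> x) (at x within {0..l})"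
    and "continuous_on {0..l} \<psi>"
  shows "abs_continuous_on_interval 0 l \<phi>"
  unfolding abs_continuous_on_interval_def
proof (intro allI impI)
  obtain C where C: "\<And>x y. x \<in> {0..l} \<Longrightarrow> y \<in> {0..l} \<Longrightarrow> norm (\<phi> y - \<phi> x) \<le> C * \<bar>y - x\<bar>" "0 \<le> C"
    using C1_lipschitz[OF assms] by blast
  fix \<epsilon> :: real assume e: "\<epsilon> > 0"
  have "(\<Sum>i<n. norm (\<phi> (y i) - \<phi> (x i))) < \<epsilon>"
    if xy: "\<forall>i<n. 0 \<le> x i \<and> x i \<le> y i \<and> y i \<le> l" and s: "(\<Sum>i<n. y i - x i) < \<epsilon> / (C + 1)"
    for n :: nat and x y
  proof -
    have "(\<Sum>i<n. norm (\<phi> (y i) - \<phi> (x i))) \<le> (\<Sum>i<n. (C + 1) * (y i - x i))"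
    proof (rule sum_mono)
      fix i assume "i \<in> {..<n}"
      hence i: "0 \<le> x i" "x i \<le> y i" "y i \<le> l" using xy by auto
      hence "norm (\<phi> (y i) - \<phi> (x i)) \<le> C * \<bar>y i - x i\<bar>" by (intro C(1)) auto
      also have "\<dots> \<le> (C + 1) * (y i - x i)" using i by (simp add: algebra_simps)
      finally show "norm (\<phi> (y i) - \<phi> (x i)) \<le> (C + 1) * (y i - x i)" .
    qed
    also have "\<dots> = (C + 1) * (\<Sum>i<n. y i - x i)" by (simp add: sum_distrib_left)
    also have "\<dots> < (C + 1) * (\<epsilon> / (C + 1))" using C(2) by (intro mult_strict_left_mono s) auto
    finally show ?thesis using C(2) by simp
  qed
  thus "\<exists>\<delta>>0. \<forall>(n::nat) x y. (\<forall>i<n. 0 \<le> x i \<and> x i \<le> y i \<and> y i \<le> l) \<longrightarrow>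
      disjoint_family_on (\<lambda>i. {x i<..<y i}) {..<n} \<longrightarrow> (\<Sum>i<n. y i - x i) < \<delta> \<longrightarrow>
      (\<Sum>i<n. norm (\<phi> (y i) - \<phi> (x i))) < \<epsilon>"
    using e C(2) by (intro exI[of _ "\<epsilon> / (C + 1)"]) auto
qed

lemma continuous_square_integrable:
  assumes "continuous_on {a..b} \<phi>"
  shows "square_integrable_on_interval a b \<phi>"
  unfolding square_integrable_on_interval_def
  using assms by (intro conjI continuous_imp_measurable_on_sets_lebesgue continuous_imp_integrable_real continuous_intros) auto

lemma square_integrable_cong:
  assumes "\<And>x. x \<in> {a..b} \<Longrightarrow> \<phi> x = \<psi> x"
  shows "square_integrable_on_interval a b \<phi> \<longleftrightarrow> square_integrable_on_interval a b \<psi>"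
  unfolding square_integrable_on_interval_def
  by (intro conj_cong measurable_cong Bochner_Integration.integrable_cong) (auto simp: assms)

lemma abs_continuous_cong:
  assumes "\<And>x. x \<in> {a..b} \<Longrightarrow> \<phi> x = \<psi> x"
  shows "abs_continuous_on_interval a b \<phi> \<longleftrightarrow> abs_continuous_on_interval a b \<psi>"
proof -
  have *: "abs_continuous_on_interval a b \<psi>"
    if ac: "abs_continuous_on_interval a b \<phi>" and eq: "\<And>x. x \<in> {a..b} \<Longrightarrow> \<phi> x = \<psi> x" for \<phi> \<psi>
    unfolding abs_continuous_on_interval_def
  proof (intro allI impI)
    fix \<epsilon> :: real assume "\<epsilon> > 0"
    then obtain \<delta> where \<delta>: "\<delta> > 0" "\<And>(n::nat) x y. \<lbrakk>\<forall>i<n. a \<le> x i \<and> x i \<le> y i \<and> y i \<le> b;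
      disjoint_family_on (\<lambda>i. {x i<..<y i}) {..<n}; (\<Sum>i<n. y i - x i) < \<delta>\<rbrakk> \<Longrightarrow> (\<Sum>i<n. norm (\<phi> (y i) - \<phi> (x i))) < \<epsilon>"
      using ac unfolding abs_continuous_on_interval_def by meson
    have "(\<Sum>i<n. norm (\<psi> (y i) - \<psi> (x i))) = (\<Sum>i<n. norm (\<phi> (y i) - \<phi> (x i)))"
      if "\<forall>i<n. a \<le> x i \<and> x i \<le> y i \<and> y i \<le> b" for n :: nat and x y
      by (intro sum.cong refl) (use that in \<open>force simp: eq\<close>)
    thus "\<exists>\<delta>>0. \<forall>(n::nat) x y. (\<forall>i<n. a \<le> x i \<and> x i \<le> y i \<and> y i \<le> b) \<longrightarrow>
      disjoint_family_on (\<lambda>i. {x i<..<y i}) {..<n} \<longrightarrow> (\<Sum>i<n. y i - x i) < \<delta> \<longrightarrow>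
      (\<Sum>i<n. norm (\<psi> (y i) - \<psi> (x i))) < \<epsilon>"
      using \<delta> by (intro exI[of _ \<delta>]) auto
  qed
  show ?thesis using *[of \<phi> \<psi>] *[of \<psi> \<phi>] assms by auto
qed

lemma deriv_on_iterated:
  assumes l: "0 < l"
    and d1: "\<And>x. x \<in> {0..l} \<Longrightarrow> (\<phi> has_vector_derivative \<psi> x) (at x within {0..l})"
    and d2: "\<And>x. x \<in> {0..l} \<Longrightarrow> (\<psi> has_vector_derivative \<theta> x) (at x within {0..l})"
    and x: "x \<in> {0..l}"
  shows "deriv_on l \<phi> x = \<psi> x" "(deriv_on l \<phi> has_vector_derivative \<theta> x) (at x within {0..l})"
    "deriv_on l (deriv_on l \<phi>) x = \<theta> x"
proof -
  have eq: "deriv_on l \<phi> x = \<psi> x" if "x \<in> {0..l}" for x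
    using deriv_on_eqI[OF d1[OF that] that l] .
  show "deriv_on l \<phi> x = \<psi> x" by (rule eq[OF x])
  show "(deriv_on l \<phi> has_vector_derivative \<theta> x) (at x within {0..l})"
    by (rule has_vector_derivative_transform_within[OF d2[OF x] zero_less_one x]) (simp add: eq)
  thus "deriv_on l (deriv_on l \<phi>) x = \<theta> x" by (rule deriv_on_eqI[OF _ x l])
qed

lemma smooth_in_max_dom:
  assumes l: "\<And>e. e \<in> edges G \<Longrightarrow> 0 < len G e"
    and z: "\<And>e x. e \<notin> edges G \<or> x \<notin> {0..len G e} \<Longrightarrow> f e x = 0"
    and d1: "\<And>e x. e \<in> edges G \<Longrightarrow> x \<in> {0..len G e} \<Longrightarrow> (f e has_vector_derivative f1 e x) (at x within {0..len G e})"
    and d2: "\<And>e x. e \<in> edges G \<Longrightarrow> x \<in> {0..len G e} \<Longrightarrow> (f1 e has_vector_derivative f2 e x) (at x within {0..len G e})"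
    and c: "\<And>e. e \<in> edges G \<Longrightarrow> continuous_on {0..len G e} (f2 e)"
  shows "f \<in> max_dom G"
  unfolding max_dom_def
proof (intro CollectI conjI ballI allI impI)
  fix e assume e: "e \<in> edges G"
  note it = deriv_on_iterated[OF l[OF e] d1[OF e] d2[OF e]]
  have c0: "continuous_on {0..len G e} (f e)" and c1: "continuous_on {0..len G e} (f1 e)"
    using d1[OF e] d2[OF e] has_vector_derivative_continuous
    by (fastforce simp: continuous_on_eq_continuous_within)+
  show "square_integrable_on_interval 0 (len G e) (f e)" by (rule continuous_square_integrable[OF c0])
  show "abs_continuous_on_interval 0 (len G e) (f e)" by (rule C1_abs_continuous[OF d1[OF e] c1])
  show "f e differentiable (at x within {0..len G e})" if "x \<in> {0..len G e}" for x
    using d1[OF e that] by (rule differentiableI_vector)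
  have "abs_continuous_on_interval 0 (len G e) (f1 e)" by (rule C1_abs_continuous[OF d2[OF e] c[OF e]])
  thus "abs_continuous_on_interval 0 (len G e) (deriv_on (len G e) (f e))"
    by (subst abs_continuous_cong[OF it(1)])
  have "square_integrable_on_interval 0 (len G e) (deriv_on (len G e) (deriv_on (len G e) (f e)))
      \<longleftrightarrow> square_integrable_on_interval 0 (len G e) (f2 e)"
    by (rule square_integrable_cong) (rule it(3))
  thus "square_integrable_on_interval 0 (len G e) (deriv_on (len G e) (deriv_on (len G e) (f e)))"
    using continuous_square_integrable[OF c[OF e]] by simp
qed (use z in auto)

text \<open>Functions of the maximal domain are differentiable, hence continuous, on each closed
  edge. So \<open>- (w\<^sup>2) * f e\<close> is a continuous right-hand side and the equation
  extends from almost every point to all of them.\<close>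

lemma eigenfunction_derivatives:
  fixes w :: complex
  assumes f: "f \<in> max_dom G" and e: "e \<in> edges G" and l: "0 < len G e"
    and ae: "AE x in lebesgue_on {0..len G e}. w\<^sup>2 * f e x = - deriv_on (len G e) (deriv_on (len G e) (f e)) x"
    and x: "x \<in> {0..len G e}"
  shows "(f e has_vector_derivative deriv_on (len G e) (f e) x) (at x within {0..len G e})"
    "(deriv_on (len G e) (f e) has_vector_derivative - (w\<^sup>2) * f e x) (at x within {0..len G e})"
proof -
  have 1: "(f e has_vector_derivative deriv_on (len G e) (f e) x) (at x within {0..len G e})"
    if "x \<in> {0..len G e}" for x
    using f e that unfolding max_dom_def deriv_on_def by (simp add: vector_derivative_works)
  show "(f e has_vector_derivative deriv_on (len G e) (f e) x) (at x within {0..len G e})" by (rule 1[OF x])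
  have c: "continuous_on {0..len G e} (f e)"
    using 1 has_vector_derivative_continuous by (fastforce simp: continuous_on_eq_continuous_within)
  show "(deriv_on (len G e) (f e) has_vector_derivative - (w\<^sup>2) * f e x) (at x within {0..len G e})"
  proof (rule abs_continuous_deriv_on_ae[OF _ l _ _ x])
    show "abs_continuous_on_interval 0 (len G e) (deriv_on (len G e) (f e))"
      using f e by (auto simp: max_dom_def)
    show "continuous_on {0..len G e} (\<lambda>x. - (w\<^sup>2) * f e x)" by (intro continuous_intros c)
    show "AE x in lebesgue_on {0..len G e}. deriv_on (len G e) (deriv_on (len G e) (f e)) x = - (w\<^sup>2) * f e x"
      using ae by eventually_elim (metis minus_mult_left minus_minus)
  qed
qed

section \<open>Eigenvalues of cycles\<close>

lemma gfun_span_pair: "gfun.span {a, b} = {cscale c a + cscale d b | c d. True}"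
proof -
  have "f \<in> gfun.span {a, b} \<longleftrightarrow> (\<exists>c d. f = cscale c a + cscale d b)" for f
  proof -
    have "f \<in> gfun.span {a, b} \<longleftrightarrow> (\<exists>c d. f - cscale c a - cscale d b = 0)"
      by (simp only: gfun.span_breakdown_eq gfun.span_empty singleton_iff)
    thus ?thesis by (simp only: diff_diff_eq right_minus_eq)
  qed
  thus ?thesis by blast
qed

text \<open>All edges are oriented the same way round, so each vertex is the head of one edge and
  the tail of the next. By \<open>2 \<le> n\<close> these two edges differ, and sums over incident
  edges have exactly two terms.\<close>

locale cycle_graph =
  fixes G :: "('v, 'e) mgraph" and n :: nat and V :: "nat \<Rightarrow> 'v" and E :: "nat \<Rightarrow> 'e"
  assumes n: "2 \<le> n"
    and edges: "edges G = E ` {..<n}" and inj_E: "inj_on E {..<n}"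
    and verts: "verts G = V ` {..<n}" and inj_V: "inj_on V {..<n}"
    and tail: "\<And>j. j < n \<Longrightarrow> tail G (E j) = V j"
    and head: "\<And>j. j < n \<Longrightarrow> head G (E j) = V (Suc j mod n)"
    and len_pos: "\<And>j. j < n \<Longrightarrow> 0 < len G (E j)"
begin

abbreviation next_index :: "nat \<Rightarrow> nat" where "next_index j \<equiv> Suc j mod n"
abbreviation L :: "nat \<Rightarrow> real" where "L j \<equiv> len G (E j)"

definition offset :: "nat \<Rightarrow> real" where "offset j = (\<Sum>i<j. L i)"

abbreviation total :: real where "total \<equiv> offset n"

definition index :: "'e \<Rightarrow> nat" where "index e = the_inv_into {..<n} E e"

lemma index: "j < n \<Longrightarrow> index (E j) = j"
  by (simp add: index_def the_inv_into_f_f[OF inj_E])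

lemma offset_0 [simp]: "offset 0 = 0" by (simp add: offset_def)

lemma offset_Suc: "offset (Suc j) = offset j + L j" by (simp add: offset_def)

lemma next_index_cases:
  assumes "j < n"
  obtains "Suc j < n" "next_index j = Suc j" | "Suc j = n" "next_index j = 0"
  using assms n by (cases "Suc j = n") auto

lemma next_index_less [simp]: "next_index j < n" using n by simp

lemma next_index_neq:
  assumes "j < n"
  shows "next_index j \<noteq> j"
  by (cases rule: next_index_cases[OF assms]) (use n in auto)

lemma next_index_inj:
  assumes i: "i < n" and j: "j < n"
  shows "next_index i = next_index j \<longleftrightarrow> i = j"
  by (cases rule: next_index_cases[OF i]; cases rule: next_index_cases[OF j]) auto

lemma next_index_surj: "i < n \<Longrightarrow> \<exists>j<n. i = next_index j"
proof (cases i)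
  case 0
  thus ?thesis using n by (intro exI[of _ "n - 1"]) auto
next
  case (Suc j)
  thus "i < n \<Longrightarrow> ?thesis" by (intro exI[of _ j]) auto
qed

lemma total_pos: "0 < total"
proof -
  have "0 \<in> {..<n}" using n by simp
  thus ?thesis unfolding offset_def using len_pos by (intro sum_pos) auto
qed

section \<open>Vertex conditions as jump conditions\<close>

lemma incident_eq:
  assumes "j < n"
  shows "incident G (V (next_index j)) = {E j, E (next_index j)}" "E j \<noteq> E (next_index j)"
proof -
  have V: "V i = V k \<longleftrightarrow> i = k" if "i < n" "k < n" for i k using inj_V that by (auto simp: inj_on_def)
  show "incident G (V (next_index j)) = {E j, E (next_index j)}"
    using assms by (auto simp: incident_def edges ends_def tail head V next_index_inj)
  show "E j \<noteq> E (next_index j)"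
    using next_index_neq[OF assms] inj_E assms by (auto simp: inj_on_def)
qed

lemma vertex_data:
  assumes "j < n"
  shows "vertex_value G f (V (next_index j)) (E j) = f (E j) (L j)"
    "vertex_value G f (V (next_index j)) (E (next_index j)) = f (E (next_index j)) 0"
    "outgoing_deriv G f (V (next_index j)) (E j) = - deriv_on (L j) (f (E j)) (L j)"
    "outgoing_deriv G f (V (next_index j)) (E (next_index j)) = deriv_on (L (next_index j)) (f (E (next_index j))) 0"
proof -
  have "V (next_index j) \<noteq> tail G (E j)"
    using assms inj_V next_index_neq[OF assms] by (auto simp: tail inj_on_def)
  thus "vertex_value G f (V (next_index j)) (E j) = f (E j) (L j)"
    "vertex_value G f (V (next_index j)) (E (next_index j)) = f (E (next_index j)) 0"
    "outgoing_deriv G f (V (next_index j)) (E j) = - deriv_on (L j) (f (E j)) (L j)"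
    "outgoing_deriv G f (V (next_index j)) (E (next_index j)) = deriv_on (L (next_index j)) (f (E (next_index j))) 0"
    by (simp_all add: vertex_value_def outgoing_deriv_def tail)
qed

text \<open>Derivatives are taken along the orientation here. The outgoing derivative at a head
  carries a minus sign, so a vanishing sum of outgoing derivatives means that \<open>f'\<close>
  continues, and their equality means that \<open>f'\<close> changes sign. That is why one factor
  \<open>s\<close> governs both values and derivatives.\<close>

definition jump_dom :: "complex \<Rightarrow> 'e gfun set" where
  "jump_dom s = {f \<in> max_dom G. \<forall>j<n. f (E (next_index j)) 0 = s * f (E j) (L j) \<and>
     deriv_on (L (next_index j)) (f (E (next_index j))) 0 = s * deriv_on (L j) (f (E j)) (L j)}"

text \<open>Addressing a vertex as \<open>V (next_index j)\<close> presents its two edges as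
  \<open>E j\<close>, which ends there, and \<open>E (next_index j)\<close>, which starts
  there.\<close>

lemma Ball_verts: "(\<forall>v\<in>verts G. P v) \<longleftrightarrow> (\<forall>j<n. P (V (next_index j)))"
  unfolding verts using next_index_surj by (auto simp: Ball_def)

lemma vertex_conditions:
  fixes f :: "'e gfun"
  assumes j: "j < n"
  defines "I \<equiv> incident G (V (next_index j))" and "val \<equiv> vertex_value G f (V (next_index j))"
    and "der \<equiv> outgoing_deriv G f (V (next_index j))"
  shows "(\<forall>e\<in>I. \<forall>e'\<in>I. val e = val e') \<longleftrightarrow> f (E (next_index j)) 0 = 1 * f (E j) (L j)"
    "(\<Sum>e\<in>I. val e) = 0 \<longleftrightarrow> f (E (next_index j)) 0 = - 1 * f (E j) (L j)"
    "(\<forall>e\<in>I. \<forall>e'\<in>I. der e = der e') \<longleftrightarrow>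
      deriv_on (L (next_index j)) (f (E (next_index j))) 0 = - 1 * deriv_on (L j) (f (E j)) (L j)"
    "(\<Sum>e\<in>I. der e) = 0 \<longleftrightarrow>
      deriv_on (L (next_index j)) (f (E (next_index j))) 0 = 1 * deriv_on (L j) (f (E j)) (L j)"
proof -
  have I: "I = {E j, E (next_index j)}" unfolding I_def by (rule incident_eq[OF j])
  have sum: "sum g I = g (E j) + g (E (next_index j))" for g :: "'e \<Rightarrow> complex"
    unfolding I using incident_eq(2)[OF j] by simp
  note data = vertex_data[OF j, of f, folded val_def der_def]
  show "(\<forall>e\<in>I. \<forall>e'\<in>I. val e = val e') \<longleftrightarrow> f (E (next_index j)) 0 = 1 * f (E j) (L j)"
    "(\<forall>e\<in>I. \<forall>e'\<in>I. der e = der e') \<longleftrightarrow>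
      deriv_on (L (next_index j)) (f (E (next_index j))) 0 = - 1 * deriv_on (L j) (f (E j)) (L j)"
    unfolding I by (auto simp: data)
  show "(\<Sum>e\<in>I. val e) = 0 \<longleftrightarrow> f (E (next_index j)) 0 = - 1 * f (E j) (L j)"
    "(\<Sum>e\<in>I. der e) = 0 \<longleftrightarrow>
      deriv_on (L (next_index j)) (f (E (next_index j))) 0 = 1 * deriv_on (L j) (f (E j)) (L j)"
    unfolding sum data by (simp_all add: add_eq_0_iff)
qed

lemma dom_st_eq: "dom_st G = jump_dom 1"
  unfolding dom_st_def jump_dom_def Ball_verts
  by (intro Collect_cong conj_cong refl all_cong) (rule vertex_conditions, assumption)+

lemma dom_ast_eq: "dom_ast G = jump_dom (- 1)"
proof -
  have "jump_dom (- 1) = {f \<in> max_dom G. \<forall>j<n.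
      deriv_on (L (next_index j)) (f (E (next_index j))) 0 = - 1 * deriv_on (L j) (f (E j)) (L j) \<and>
      f (E (next_index j)) 0 = - 1 * f (E j) (L j)}"
    unfolding jump_dom_def by (intro Collect_cong conj_cong refl all_cong conj_commute)
  also have "\<dots> = dom_ast G"
    unfolding dom_ast_def Ball_verts
    by (intro Collect_cong conj_cong refl all_cong) (rule vertex_conditions[symmetric], assumption)+
  finally show ?thesis by simp
qed

section \<open>Waves and eigenspaces\<close>

text \<open>The exponential in arc length, with a factor \<open>s\<close> for every vertex passed.\<close>

definition wave :: "complex \<Rightarrow> complex \<Rightarrow> 'e gfun" where
  "wave s w = (\<lambda>e x. if e \<in> edges G \<and> x \<in> {0..len G e}
     then s ^ index e * exp (\<i> * w * (offset (index e) + x)) else 0)"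

lemma wave_E:
  "j < n \<Longrightarrow> x \<in> {0..L j} \<Longrightarrow> wave s w (E j) x = s ^ j * exp (\<i> * w * (offset j + x))"
  by (simp add: wave_def edges index)

text \<open>Allowing a zero coefficient in place of the closing condition covers the zero function
  at values of \<open>w\<close> where no wave closes up.\<close>

lemma wave_combination_eigenfunction:
  assumes w: "w\<^sup>2 = complex_of_real \<mu>"
    and c: "c = 0 \<or> s ^ n * exp (\<i> * w * total) = 1" "d = 0 \<or> s ^ n * exp (\<i> * (- w) * total) = 1"
  shows "cscale c (wave s w) + cscale d (wave s (- w)) \<in> eigenspace (neg_second_deriv_on G (jump_dom s)) \<mu>"
proof -
  define f where "f = cscale c (wave s w) + cscale d (wave s (- w))"
  define p where "p j x = c * (s ^ j * exp (\<i> * w * (offset j + x)))" for j :: nat and x :: real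
  define q where "q j x = d * (s ^ j * exp (\<i> * (- w) * (offset j + x)))" for j :: nat and x :: real
  have dp: "(p j has_vector_derivative \<i> * w * p j x) (at x within S)" for j x S
    unfolding p_def of_real_add by (rule has_vector_derivative_real_field) (auto intro!: derivative_eq_intros)
  have dq: "(q j has_vector_derivative \<i> * (- w) * q j x) (at x within S)" for j x S
    unfolding q_def of_real_add by (rule has_vector_derivative_real_field) (auto intro!: derivative_eq_intros)
  have f: "f (E j) x = p j x + q j x" if "j < n" "x \<in> {0..L j}" for j x
    using that by (simp add: f_def p_def q_def cscale_def wave_E)
  have f0: "f e x = 0" if "e \<notin> edges G \<or> x \<notin> {0..len G e}" for e x
    using that by (auto simp: f_def cscale_def wave_def)
  define f1 where "f1 j x = \<i> * w * p j x + \<i> * (- w) * q j x" for j x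
  define f2 where "f2 j x = (\<i> * w) * (\<i> * w * p j x) + (\<i> * (- w)) * (\<i> * (- w) * q j x)" for j x
  have d1: "(f (E j) has_vector_derivative f1 j x) (at x within {0..L j})" if "j < n" "x \<in> {0..L j}" for j x
  proof (rule has_vector_derivative_transform[OF that(2)])
    show "((\<lambda>x. p j x + q j x) has_vector_derivative f1 j x) (at x within {0..L j})"
      unfolding f1_def by (intro has_vector_derivative_add dp dq)
  qed (rule f[OF that(1)])
  have d2: "(f1 j has_vector_derivative f2 j x) (at x within {0..L j})" for j x
    unfolding f1_def f2_def by (intro has_vector_derivative_add has_vector_derivative_mult_right dp dq)
  have f2: "f2 j x = - complex_of_real \<mu> * (p j x + q j x)" for j x
    by (simp add: f2_def algebra_simps flip: w power2_eq_square)
       (simp add: power2_eq_square)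
  have cont2: "continuous_on S (f2 j)" for j S
    unfolding f2_def p_def q_def by (intro continuous_intros)
  have "f \<in> max_dom G"
  proof (rule smooth_in_max_dom[where ?f1.0 = "\<lambda>e. f1 (index e)" and ?f2.0 = "\<lambda>e. f2 (index e)"])
    fix e x assume e: "e \<in> edges G" and x: "x \<in> {0..len G e}"
    then obtain j where j: "j < n" "e = E j" by (auto simp: edges)
    show "(f e has_vector_derivative f1 (index e) x) (at x within {0..len G e})"
      using d1[OF j(1)] x by (simp add: j index)
    show "(f1 (index e) has_vector_derivative f2 (index e) x) (at x within {0..len G e})"
      using d2 x by (simp add: j index)
  qed (use len_pos f0 cont2 in \<open>auto simp: edges\<close>)
  moreover have jump: "p (next_index j) 0 = s * p j (L j)" "q (next_index j) 0 = s * q j (L j)" if "j < n" for j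
  proof -
    have "p (next_index j) 0 = s * p j (L j) \<and> q (next_index j) 0 = s * q j (L j)"
    proof (cases rule: next_index_cases[OF that])
      case 1
      thus ?thesis by (simp add: p_def q_def offset_Suc)
    next
      \<comment> \<open>Only the return from the last edge to edge 0 uses the closing condition; at
        all other vertices the factor \<open>s ^ j\<close> already produces the jump.\<close>
      case 2
      hence t: "offset j + L j = total" by (metis offset_Suc)
      have "s * p j (L j) = c * (s ^ n * exp (\<i> * w * total))"
        "s * q j (L j) = d * (s ^ n * exp (\<i> * (- w) * total))"
        unfolding p_def q_def using 2(1) t by (auto simp flip: of_real_add)
      moreover have "c * (s ^ n * exp (\<i> * w * total)) = c" "d * (s ^ n * exp (\<i> * (- w) * total)) = d"
        using c by auto
      moreover have "p 0 0 = c" "q 0 0 = d" by (simp_all add: p_def q_def)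
      ultimately show ?thesis unfolding 2(2) by argo
    qed
    thus "p (next_index j) 0 = s * p j (L j)" "q (next_index j) 0 = s * q j (L j)" by auto
  qed
  have D: "deriv_on (L j) (f (E j)) x = f1 j x" "deriv_on (L j) (deriv_on (L j) (f (E j))) x = f2 j x"
    if "j < n" "x \<in> {0..L j}" for j x
    using deriv_on_iterated[OF len_pos[OF that(1)] d1[OF that(1)] d2 that(2)] by auto
  have "f \<in> jump_dom s"
    unfolding jump_dom_def
  proof (intro CollectI conjI allI impI)
    fix j assume j: "j < n"
    have mem: "0 \<in> {0..L (next_index j)}" "L j \<in> {0..L j}"
      using len_pos[OF next_index_less] len_pos[OF j] by (simp_all add: less_imp_le)
    show "f (E (next_index j)) 0 = s * f (E j) (L j)"
      by (simp only: f[OF next_index_less mem(1)] f[OF j mem(2)] jump[OF j] distrib_left)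
    show "deriv_on (L (next_index j)) (f (E (next_index j))) 0 = s * deriv_on (L j) (f (E j)) (L j)"
      by (simp only: D[OF next_index_less mem(1)] D[OF j mem(2)] f1_def jump[OF j]) (simp add: algebra_simps)
  qed fact
  moreover have "AE x in lebesgue_on {0..len G e}. cscale \<mu> f e x = - deriv_on (len G e) (deriv_on (len G e) (f e)) x"
    if e: "e \<in> edges G" for e
  proof (rule AE_I2)
    fix x assume x: "x \<in> space (lebesgue_on {0..len G e})"
    obtain j where j: "j < n" "e = E j" using e by (auto simp: edges)
    have "x \<in> {0..L j}" using x j by simp
    thus "cscale \<mu> f e x = - deriv_on (len G e) (deriv_on (len G e) (f e)) x"
      using j by (simp add: D f f2 cscale_def)
  qed
  ultimately show ?thesis unfolding f_def[symmetric] eigenspace_def neg_second_deriv_on_def by blast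
qed

text \<open>Each edge contributes an exponential and each vertex a factor \<open>s\<close>, because
  the jump conditions act alike on \<open>f\<close> and its derivative. After a full turn
  \<open>u 0 0\<close> is multiplied by the closing factor and must return to itself.\<close>

lemma eigenfunction_transport:
  assumes f: "f \<in> eigenspace (neg_second_deriv_on G (jump_dom s)) \<mu>" and w: "w\<^sup>2 = complex_of_real \<mu>"
  defines "u \<equiv> \<lambda>j x. deriv_on (L j) (f (E j)) x + \<i> * w * f (E j) x"
  shows "j < n \<Longrightarrow> x \<in> {0..L j} \<Longrightarrow> u j x = s ^ j * exp (\<i> * w * (offset j + x)) * u 0 0"
    and "u 0 0 = 0 \<or> s ^ n * exp (\<i> * w * total) = 1"
proof -
  have dom: "f \<in> jump_dom s" and max: "f \<in> max_dom G"
    and ae: "\<And>e. e \<in> edges G \<Longrightarrow> AE x in lebesgue_on {0..len G e}.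
      w\<^sup>2 * f e x = - deriv_on (len G e) (deriv_on (len G e) (f e)) x"
    using f by (auto simp: eigenspace_def neg_second_deriv_on_def jump_dom_def cscale_def w)
  have step: "u j x = exp (\<i> * w * x) * u j 0" if j: "j < n" and x: "x \<in> {0..L j}" for j x
  proof -
    have e: "E j \<in> edges G" using j by (simp add: edges)
    show ?thesis unfolding u_def
      by (rule first_order_form[OF eigenfunction_derivatives[OF max e len_pos[OF j] ae[OF e]] x])
  qed
  have jump: "u (next_index j) 0 = s * exp (\<i> * w * L j) * u j 0" if j: "j < n" for j
  proof -
    have "u (next_index j) 0 = s * u j (L j)"
      using dom j by (simp add: jump_dom_def u_def algebra_simps)
    thus ?thesis using step[OF j, of "L j"] len_pos[OF j] by simp
  qed
  have at0: "u j 0 = s ^ j * exp (\<i> * w * offset j) * u 0 0" if "j < n" for j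
    using that
  proof (induction j)
    case (Suc j)
    hence "u (Suc j) 0 = s * exp (\<i> * w * L j) * u j 0" using jump[of j] by simp
    thus ?case using Suc by (simp add: offset_Suc algebra_simps exp_add)
  qed simp
  show "u j x = s ^ j * exp (\<i> * w * (offset j + x)) * u 0 0" if "j < n" "x \<in> {0..L j}"
    using step[OF that] at0[OF that(1)] by (simp add: algebra_simps exp_add)
  define m where "m = n - 1"
  have m: "m < n" "n = Suc m" using n by (auto simp: m_def)
  have "u 0 0 = s * exp (\<i> * w * L m) * u m 0" using jump[OF m(1)] m(2) by simp
  also have "\<dots> = s ^ n * exp (\<i> * w * total) * u 0 0"
    using at0[OF m(1)] by (simp add: m(2) offset_Suc algebra_simps exp_add)
  finally show "u 0 0 = 0 \<or> s ^ n * exp (\<i> * w * total) = 1" by auto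
qed

text \<open>For \<open>w \<noteq> 0\<close>, subtracting the transport formulas for \<open>w\<close>
  and \<open>- w\<close> isolates \<open>2 * \<i> * w * f\<close>. For \<open>w = 0\<close> the two
  waves coincide and the span is one-dimensional.\<close>

lemma eigenspace_eq:
  assumes s: "s ^ n = 1 \<or> s ^ n = - 1" and w: "w\<^sup>2 = complex_of_real \<mu>"
  shows "eigenspace (neg_second_deriv_on G (jump_dom s)) \<mu> =
    (if s ^ n * exp (\<i> * w * total) = 1 then gfun.span {wave s w, wave s (- w)} else {0})"
    (is "?E = (if ?c w then _ else _)")
proof -
  \<comment> \<open>The exponentials for \<open>w\<close> and \<open>- w\<close> are inverse to each
    other, and \<open>s ^ n\<close> is its own inverse, so both waves close up together.\<close>
  have c_minus: "?c (- w) \<longleftrightarrow> ?c w"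
  proof -
    have "exp (\<i> * (- w) * total) * exp (\<i> * w * total) = 1" by (simp flip: exp_add)
    thus ?thesis using s by (auto simp: minus_equation_iff) (metis mult_1 mult.commute minus_mult_minus)+
  qed
  have mem: "cscale c (wave s w) + cscale d (wave s (- w)) \<in> ?E" if "?c w" for c d
    using that c_minus by (intro wave_combination_eigenfunction w) auto
  have zero: "0 \<in> ?E"
  proof -
    have "cscale 0 (wave s w) + cscale 0 (wave s (- w)) \<in> ?E"
      by (intro wave_combination_eigenfunction w) auto
    moreover have "cscale 0 (wave s w) + cscale 0 (wave s (- w)) = 0" by (simp add: cscale_def fun_eq_iff)
    ultimately show ?thesis by simp
  qed
  have comb: "\<exists>c d. f = cscale c (wave s w) + cscale d (wave s (- w)) \<and> (?c w \<or> c = 0 \<and> d = 0)"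
    if f: "f \<in> ?E" for f
  proof -
    have dom: "f \<in> jump_dom s" and max: "f \<in> max_dom G"
      and ae: "\<And>e. e \<in> edges G \<Longrightarrow> AE x in lebesgue_on {0..len G e}.
        w\<^sup>2 * f e x = - deriv_on (len G e) (deriv_on (len G e) (f e)) x"
      using f by (auto simp: eigenspace_def neg_second_deriv_on_def jump_dom_def cscale_def w)
    have out: "f e x = 0" if "e \<notin> edges G \<or> x \<notin> {0..len G e}" for e x
      using max that by (auto simp: max_dom_def)
    have eqI: "f = cscale c (wave s w) + cscale d (wave s (- w))"
      if "\<And>j x. j < n \<Longrightarrow> x \<in> {0..L j} \<Longrightarrow> f (E j) x = c * wave s w (E j) x + d * wave s (- w) (E j) x" for c d
    proof (intro ext)
      fix e x
      show "f e x = (cscale c (wave s w) + cscale d (wave s (- w))) e x"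
      proof (cases "e \<in> edges G \<and> x \<in> {0..len G e}")
        case True
        then obtain j where "j < n" "e = E j" by (auto simp: edges)
        thus ?thesis using that[of j x] True by (simp add: cscale_def)
      next
        case False
        thus ?thesis using out[of e x] by (auto simp: cscale_def wave_def)
      qed
    qed
    have w': "(- w)\<^sup>2 = complex_of_real \<mu>" using w by simp
    define d0 where "d0 j x = deriv_on (L j) (f (E j)) x" for j x
    define u where "u = d0 0 0 + \<i> * w * f (E 0) 0"
    define v where "v = d0 0 0 + \<i> * (- w) * f (E 0) 0"
    have u: "d0 j x + \<i> * w * f (E j) x = wave s w (E j) x * u" if "j < n" "x \<in> {0..L j}" for j x
      using eigenfunction_transport(1)[OF f w that] wave_E[OF that] by (simp add: u_def d0_def)
    have v: "d0 j x + \<i> * (- w) * f (E j) x = wave s (- w) (E j) x * v" if "j < n" "x \<in> {0..L j}" for j x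
      using eigenfunction_transport(1)[OF f w' that] wave_E[OF that] by (simp add: v_def d0_def)
    have u0: "u = 0 \<or> ?c w" using eigenfunction_transport(2)[OF f w] by (simp add: u_def d0_def)
    have v0: "v = 0 \<or> ?c w" using eigenfunction_transport(2)[OF f w'] c_minus by (simp add: v_def d0_def)
    show ?thesis
    proof (cases "w = 0")
      case False
      have "f = cscale (u / (2 * \<i> * w)) (wave s w) + cscale (- v / (2 * \<i> * w)) (wave s (- w))"
      proof (rule eqI)
        fix j x assume jx: "j < n" "x \<in> {0..L j}"
        have "2 * \<i> * w * f (E j) x = wave s w (E j) x * u - wave s (- w) (E j) x * v"
          unfolding u[OF jx, symmetric] v[OF jx, symmetric] by (simp add: algebra_simps)
        thus "f (E j) x = u / (2 * \<i> * w) * wave s w (E j) x + - v / (2 * \<i> * w) * wave s (- w) (E j) x"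
          using False by (simp add: field_simps)
      qed
      thus ?thesis using u0 v0
        by (intro exI[of _ "u / (2 * \<i> * w)"] exI[of _ "- v / (2 * \<i> * w)"]) auto
    next
      \<comment> \<open>Now \<open>u\<close> and \<open>v\<close> both reduce to the derivative and
        cannot be solved for \<open>f\<close>. Instead \<open>f\<close> is affine on edge
        \<open>j\<close> with slope \<open>s ^ j * u\<close>.\<close>
      case True
      have wave0: "wave s 0 (E j) x = s ^ j" if "j < n" "x \<in> {0..L j}" for j x
        using wave_E[OF that, of s 0] by simp
      have lin: "f (E j) x = f (E j) 0 + s ^ j * u * x" if j: "j < n" and x: "x \<in> {0..L j}" for j x
      proof -
        have e: "E j \<in> edges G" using j by (simp add: edges)
        have "((\<lambda>x. f (E j) x - s ^ j * u * x) has_vector_derivative 0) (at y within {0..L j})"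
          if y: "y \<in> {0..L j}" for y
        proof -
          have "(f (E j) has_vector_derivative s ^ j * u) (at y within {0..L j})"
            using eigenfunction_derivatives(1)[OF max e len_pos[OF j] ae[OF e] y] u[OF j y] wave0[OF j y] True
            by (simp add: d0_def)
          moreover have "((\<lambda>x. s ^ j * u * complex_of_real x) has_vector_derivative s ^ j * u * 1) (at y within {0..L j})"
            by (rule has_vector_derivative_real_field) (auto intro!: derivative_eq_intros)
          ultimately have "((\<lambda>x. f (E j) x - s ^ j * u * x) has_vector_derivative s ^ j * u - s ^ j * u * 1) (at y within {0..L j})"
            by (rule has_vector_derivative_diff)
          thus ?thesis by simp
        qed
        from has_vector_derivative_zero_eq[OF this x] show ?thesis by (simp add: algebra_simps)
      qed
      have jump: "f (E (next_index j)) 0 = s * f (E j) 0 + s ^ Suc j * u * L j" if j: "j < n" for j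
      proof -
        have "f (E (next_index j)) 0 = s * f (E j) (L j)" using dom j by (simp add: jump_dom_def)
        also have "f (E j) (L j) = f (E j) 0 + s ^ j * u * L j" using lin[OF j, of "L j"] len_pos[OF j] by simp
        finally show ?thesis by (simp add: algebra_simps)
      qed
      have at0: "f (E j) 0 = s ^ j * (f (E 0) 0 + u * offset j)" if "j < n" for j
        using that
      proof (induction j)
        case (Suc j)
        hence "f (E (Suc j)) 0 = s * f (E j) 0 + s ^ Suc j * u * L j" using jump[of j] by simp
        thus ?case using Suc by (simp add: offset_Suc algebra_simps)
      qed simp
      define m where "m = n - 1"
      have m: "m < n" "n = Suc m" using n by (auto simp: m_def)
      have "f (E 0) 0 = s * f (E m) 0 + s ^ Suc m * u * L m" using jump[OF m(1)] m(2) by simp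
      also have "\<dots> = s ^ n * (f (E 0) 0 + u * total)"
        using at0[OF m(1)] by (simp add: m(2) offset_Suc algebra_simps)
      finally have close: "f (E 0) 0 = s ^ n * (f (E 0) 0 + u * total)" .
      \<comment> \<open>A nonzero slope would need \<open>s ^ n = 1\<close>, but then
        \<open>f\<close> would gain \<open>u * total\<close> in one turn.\<close>
      have un: "u = 0"
      proof (rule ccontr)
        assume "u \<noteq> 0"
        hence "s ^ n = 1" using u0 True by simp
        hence "u * total = 0" using close by (simp add: algebra_simps)
        thus False using \<open>u \<noteq> 0\<close> total_pos by simp
      qed
      have "f = cscale (f (E 0) 0) (wave s w) + cscale 0 (wave s (- w))"
      proof (rule eqI)
        fix j x assume jx: "j < n" "x \<in> {0..L j}"
        have "f (E j) x = f (E j) 0" using lin[OF jx] un by simp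
        also have "\<dots> = s ^ j * f (E 0) 0" using at0[OF jx(1)] un by simp
        finally have fx: "f (E j) x = s ^ j * f (E 0) 0" .
        show "f (E j) x = f (E 0) 0 * wave s w (E j) x + 0 * wave s (- w) (E j) x"
          unfolding fx True using wave0[OF jx] by simp
      qed
      \<comment> \<open>With slope zero, the closing equation makes the starting value equal to
        \<open>s ^ n\<close> times itself, so it vanishes when \<open>s ^ n = - 1\<close>.\<close>
      moreover have "?c w \<or> f (E 0) 0 = 0" using close un True s by auto
      ultimately show ?thesis by blast
    qed
  qed
  show ?thesis
  proof (cases "?c w")
    case True
    have "?E = gfun.span {wave s w, wave s (- w)}"
      unfolding gfun_span_pair using mem[OF True] comb by blast
    thus ?thesis using True by simp
  next
    case False
    have "f = 0" if "f \<in> ?E" for f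
    proof -
      have "f = cscale 0 (wave s w) + cscale 0 (wave s (- w))" using comb[OF that] False by auto
      thus ?thesis by (simp add: cscale_def fun_eq_iff)
    qed
    thus ?thesis using False zero by auto
  qed
qed

section \<open>Multiplicities and explicit lists of eigenvalues\<close>

lemma wave_independent:
  assumes "0 < w"
  shows "wave s w \<notin> gfun.span {wave s (- of_real w)}"
proof
  assume "wave s w \<in> gfun.span {wave s (- of_real w)}"
  then obtain k where k: "wave s w = cscale k (wave s (- of_real w))"
    by (auto simp: gfun.span_singleton)
  have eq: "exp (\<i> * w * x) = k * exp (- (\<i> * w * x))" if "x \<in> {0..L 0}" for x
    using fun_cong[OF fun_cong[OF k], of "E 0" x] wave_E[of 0 x] that n by (simp add: cscale_def)
  \<comment> \<open>Proportionality is tested on edge 0: the point 0 forces the scalar to be 1, and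
    at \<open>x\<close> the number \<open>w * x\<close> lies in the range from 0 to
    \<open>pi / 2\<close> where the sine is positive.\<close>
  define x where "x = min (L 0) (pi / (2 * w))"
  have L0: "0 < L 0" using len_pos[of 0] n by simp
  have x: "0 < x" "x \<in> {0..L 0}" "w * x \<le> pi / 2"
    using L0 assms by (auto simp: x_def min_def field_simps)
  have "k = 1" using eq[of 0] L0 by simp
  hence "exp (\<i> * complex_of_real (w * x)) = exp (- (\<i> * complex_of_real (w * x)))"
    using eq[OF x(2)] by (simp add: mult.assoc)
  hence "Im (exp (\<i> * complex_of_real (w * x))) = Im (exp (- (\<i> * complex_of_real (w * x))))" by simp
  hence "sin (w * x) = 0" by (simp add: Im_exp)
  moreover have "0 < sin (w * x)"
    using x(3) mult_pos_pos[OF assms x(1)] pi_gt_zero by (intro sin_gt_zero) linarith+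
  ultimately show False by simp
qed

lemma wave_nonzero: "wave s w \<noteq> 0"
proof
  assume "wave s w = 0"
  hence "wave s w (E 0) 0 = 0" by simp
  thus False using wave_E[of 0 0 s w] len_pos[of 0] n by simp
qed

text \<open>Reduces the spectrum to counting in a list \<open>p\<close> of nonnegative frequencies:
  frequency zero has one wave, a positive frequency has two independent ones.\<close>

lemma eigenvalue_enumerationI:
  fixes p :: "nat \<Rightarrow> real"
  assumes s: "s ^ n = 1 \<or> s ^ n = - 1" and mono: "mono p" and nonneg: "\<And>k. 0 \<le> p k"
    and freq: "\<And>w. 0 \<le> w \<Longrightarrow> s ^ n * exp (\<i> * complex_of_real w * total) = 1 \<longleftrightarrow> (\<exists>k. p k = w)"
    and mult: "\<And>k. card {i. p i = p k} = (if p k = 0 then 1 else 2)"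
  shows "eigenvalue_enumeration (neg_second_deriv_on G (jump_dom s)) (\<lambda>k. (p k)\<^sup>2)"
  unfolding eigenvalue_enumeration_def
proof (intro conjI allI)
  show "mono (\<lambda>k. (p k)\<^sup>2)" using mono nonneg by (auto simp: mono_def intro: power_mono)
  fix \<mu> :: real
  let ?E = "eigenspace (neg_second_deriv_on G (jump_dom s)) \<mu>"
  let ?K = "{k. (p k)\<^sup>2 = \<mu>}"
  have empty: "finite ?K \<and> (\<exists>B. finite B \<and> gfun.independent B \<and> gfun.span B = ?E \<and> card B = card ?K)"
    if "?E = {0}" "?K = {}"
    using that by (intro conjI exI[of _ "{}"]) (auto simp: gfun.independent_empty)
  have "finite ?K \<and> (\<exists>B. finite B \<and> gfun.independent B \<and> gfun.span B = ?E \<and> card B = card ?K)"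
  proof (cases "\<mu> < 0")
    case True
    \<comment> \<open>A negative eigenvalue corresponds to the imaginary frequency
      \<open>\<i> * \<kappa>\<close>, whose closing factor has modulus
      \<open>exp (- (\<kappa> * total))\<close>, less than 1.\<close>
    define \<kappa> where "\<kappa> = sqrt (- \<mu>)"
    have \<kappa>: "0 < \<kappa>" "\<kappa>\<^sup>2 = - \<mu>" using True by (auto simp: \<kappa>_def)
    have w: "(\<i> * \<kappa>)\<^sup>2 = complex_of_real \<mu>"
      using \<kappa>(2) by (simp add: power_mult_distrib flip: of_real_power)
    have ns: "norm (s ^ n) = 1" using s by auto
    have "norm (s ^ n * exp (\<i> * (\<i> * \<kappa>) * total)) = exp (- (\<kappa> * total))"
      unfolding norm_mult ns by (simp add: mult.assoc[symmetric])
    hence "s ^ n * exp (\<i> * (\<i> * \<kappa>) * total) \<noteq> 1"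
      using mult_pos_pos[OF \<kappa>(1) total_pos] by (metis exp_eq_one_iff neg_equal_0_iff_equal norm_one order_less_irrefl)
    hence "?E = {0}" using eigenspace_eq[OF s w] by simp
    moreover have "?K = {}" using True by (auto simp: not_less dest: sym)
    ultimately show ?thesis by (rule empty)
  next
    case False
    define w where "w = sqrt \<mu>"
    have w: "0 \<le> w" "w\<^sup>2 = \<mu>" using False by (auto simp: w_def)
    have w2: "(complex_of_real w)\<^sup>2 = complex_of_real \<mu>" using w(2) by (simp flip: of_real_power)
    have K: "?K = {k. p k = w}" using w nonneg by (auto intro: power2_eq_imp_eq)
    note E = eigenspace_eq[OF s w2]
    show ?thesis
    proof (cases "\<exists>k. p k = w")
      case False
      hence "?E = {0}" using E freq[OF w(1)] by simp
      thus ?thesis using False K by (intro empty) auto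
    next
      case True
      then obtain k where k: "p k = w" by blast
      have span: "?E = gfun.span {wave s w, wave s (- of_real w)}" using E freq[OF w(1)] True by simp
      have card: "card ?K = (if w = 0 then 1 else 2)" using mult[of k] unfolding K k .
      hence fin: "finite ?K" by (intro card_ge_0_finite) (simp split: if_splits)
      show ?thesis
      proof (cases "w = 0")
        case True
        have "gfun.independent {wave s w}" using wave_nonzero[of s w] by simp
        thus ?thesis using fin card span True by (intro conjI exI[of _ "{wave s w}"]) auto
      next
        case False
        hence nin: "wave s w \<notin> gfun.span {wave s (- of_real w)}" using w(1) by (intro wave_independent) simp
        hence ne: "wave s w \<noteq> wave s (- of_real w)" using gfun.span_base by (metis singletonI)
        have "gfun.independent {wave s w, wave s (- of_real w)}"
          using nin wave_nonzero[of s "- of_real w"] by (simp add: gfun.independent_insert ne)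
        thus ?thesis using fin card span False ne
          by (intro conjI exI[of _ "{wave s w, wave s (- of_real w)}"]) auto
      qed
    qed
  qed
  thus "finite ?K" and "\<exists>B. finite B \<and> gfun.independent B \<and> gfun.span B = ?E \<and> card B = card ?K"
    by blast+
qed

lemma exp_total_eq_1_iff:
  "exp (\<i> * complex_of_real w * total) = 1 \<longleftrightarrow> (\<exists>m::int. w * total = 2 * pi * m)"
  by (simp add: exp_eq_1) (simp add: mult.commute mult.left_commute)

text \<open>The multiples of \<open>2 * pi / total\<close> are listed as 0, 1, 1, 2, 2, ..., which
  is \<open>(k + 1) div 2\<close> for \<open>k\<close> counted from 0.\<close>

lemma periodic_enumeration:
  assumes s: "s ^ n = 1"
  shows "eigenvalue_enumeration (neg_second_deriv_on G (jump_dom s))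
    (\<lambda>k. (2 * pi * real ((k + 1) div 2) / total)\<^sup>2)"
proof (rule eigenvalue_enumerationI)
  let ?p = "\<lambda>k. 2 * pi * real ((k + 1) div 2) / total"
  note t = total_pos
  have inj: "?p i = ?p k \<longleftrightarrow> (i + 1) div 2 = (k + 1) div 2" for i k using t by auto
  show "mono ?p" using t by (auto simp: mono_def intro!: divide_right_mono mult_left_mono div_le_mono)
  show "0 \<le> ?p k" for k using t by auto
  show "s ^ n * exp (\<i> * complex_of_real w * total) = 1 \<longleftrightarrow> (\<exists>k. ?p k = w)" if w: "0 \<le> w" for w
  proof -
    have "(\<exists>m::int. w * total = 2 * pi * m) \<longleftrightarrow> (\<exists>k. ?p k = w)"
    proof
      assume "\<exists>m::int. w * total = 2 * pi * m"
      then obtain m :: int where m: "w * total = 2 * pi * m" by blast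
      have "0 \<le> 2 * pi * m" using m w t by (metis less_imp_le mult_nonneg_nonneg)
      hence "0 \<le> m" using mult_le_cancel_left_pos[of "2 * pi" 0 "real_of_int m"] by simp
      then obtain k where "m = int k" using nonneg_int_cases by blast
      thus "\<exists>k. ?p k = w" using m t by (intro exI[of _ "2 * k"]) (simp add: field_simps)
    next
      assume "\<exists>k. ?p k = w"
      then obtain k where k: "?p k = w" by blast
      show "\<exists>m::int. w * total = 2 * pi * m"
        using t by (intro exI[of _ "int ((k + 1) div 2)"]) (simp add: k[symmetric])
    qed
    thus ?thesis using exp_total_eq_1_iff[of w] s by simp
  qed
  show "card {i. ?p i = ?p k} = (if ?p k = 0 then 1 else 2)" for k
  proof (cases "(k + 1) div 2 = 0")
    case True
    hence "{i. ?p i = ?p k} = {0}" unfolding inj by (auto simp: div_eq_0_iff)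
    thus ?thesis using True by simp
  next
    case False
    define m where "m = (k + 1) div 2"
    \<comment> \<open>Here \<open>m\<close> is positive, so the natural subtraction in
      \<open>2 * m - 1\<close> is not truncated.\<close>
    have "(i + 1) div 2 = m \<longleftrightarrow> i = 2 * m - 1 \<or> i = 2 * m" for i
      using False unfolding m_def[symmetric] by presburger
    hence "{i. ?p i = ?p k} = {2 * m - 1, 2 * m}"
      unfolding inj by (auto simp: m_def)
    thus ?thesis using False t by (simp add: m_def)
  qed
qed (use s in simp)

text \<open>Odd multiples of \<open>pi / total\<close>, each listed twice by \<open>k div 2\<close>.
  Frequency zero does not occur, so there is no simple eigenvalue.\<close>

lemma antiperiodic_enumeration:
  assumes s: "s ^ n = - 1"
  shows "eigenvalue_enumeration (neg_second_deriv_on G (jump_dom s))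
    (\<lambda>k. (pi * (2 * real (k div 2) + 1) / total)\<^sup>2)"
proof (rule eigenvalue_enumerationI)
  let ?p = "\<lambda>k. pi * (2 * real (k div 2) + 1) / total"
  note t = total_pos
  have inj: "?p i = ?p k \<longleftrightarrow> i div 2 = k div 2" for i k using t by auto
  have pos: "0 < ?p k" for k using t by (intro divide_pos_pos mult_pos_pos) auto
  show "mono ?p" using t by (auto simp: mono_def intro!: divide_right_mono mult_left_mono div_le_mono)
  show "0 \<le> ?p k" for k using pos less_imp_le by blast
  show "s ^ n * exp (\<i> * complex_of_real w * total) = 1 \<longleftrightarrow> (\<exists>k. ?p k = w)" if w: "0 \<le> w" for w
  proof -
    \<comment> \<open>The sign \<open>- 1\<close> is absorbed as \<open>exp (\<i> * pi)\<close>, a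
      shift of the frequency by \<open>pi / total\<close> that leads back to the periodic
      condition.\<close>
    have "s ^ n * exp (\<i> * complex_of_real w * total) = exp (\<i> * complex_of_real (w + pi / total) * total)"
      using t by (simp add: s algebra_simps exp_add)
    hence "s ^ n * exp (\<i> * complex_of_real w * total) = 1 \<longleftrightarrow> (\<exists>m::int. (w + pi / total) * total = 2 * pi * m)"
      by (simp only: exp_total_eq_1_iff)
    also have "\<dots> \<longleftrightarrow> (\<exists>m::int. w * total = 2 * pi * m - pi)"
    proof -
      have "(w + pi / total) * total = w * total + pi" using t by (simp add: field_simps)
      thus ?thesis by (simp only: eq_diff_eq)
    qed
    also have "\<dots> \<longleftrightarrow> (\<exists>k. ?p k = w)"
    proof
      assume "\<exists>m::int. w * total = 2 * pi * m - pi"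
      then obtain m :: int where m: "w * total = 2 * pi * m - pi" by blast
      have "0 < 2 * pi * m" using m mult_nonneg_nonneg[OF w less_imp_le[OF t]] pi_gt_zero by linarith
      hence "0 \<le> m - 1" using mult_less_cancel_left_pos[of "2 * pi" 0 "real_of_int m"] by simp
      then obtain k where "m - 1 = int k" using nonneg_int_cases by blast
      hence "real_of_int m = real k + 1" by linarith
      thus "\<exists>k. ?p k = w" using m t by (intro exI[of _ "2 * k"]) (simp add: field_simps)
    next
      assume "\<exists>k. ?p k = w"
      then obtain k where k: "?p k = w" by blast
      show "\<exists>m::int. w * total = 2 * pi * m - pi"
        using t by (intro exI[of _ "int (k div 2) + 1"]) (simp add: k[symmetric] field_simps)
    qed
    finally show ?thesis .
  qed
  show "card {i. ?p i = ?p k} = (if ?p k = 0 then 1 else 2)" for k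
  proof -
    define m where "m = k div 2"
    have "i div 2 = m \<longleftrightarrow> i = 2 * m \<or> i = 2 * m + 1" for i by presburger
    hence "{i. ?p i = ?p k} = {2 * m, 2 * m + 1}" unfolding inj by (auto simp: m_def)
    thus ?thesis using pos[of k] t by simp
  qed
qed (use s in simp)

end

section \<open>The triangle and its subdivision\<close>

lemma eigenvalue_eqI:
  assumes "eigenvalue_enumeration A s"
  shows "eigenvalue k A = s (k - 1)"
proof -
  have "(THE s. eigenvalue_enumeration A s) = s"
    by (rule the_equality[where P = "eigenvalue_enumeration A", OF assms])
       (erule eigenvalue_enumeration_unique[OF _ assms])
  thus ?thesis by (simp add: eigenvalue_def)
qed

lemma cycle_graph_triangle345: "cycle_graph triangle345 3 (\<lambda>j. j) (\<lambda>j. j)"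
proof
  have less: "j < 3 \<longleftrightarrow> j = 0 \<or> j = 1 \<or> j = 2" for j :: nat by presburger
  have set3: "{..<3} = {0, 1, 2 :: nat}" using less by (intro set_eqI) simp
  show "edges triangle345 = (\<lambda>j. j) ` {..<3}" "verts triangle345 = (\<lambda>j. j) ` {..<3}"
    unfolding set3 by (simp_all add: triangle345_def)
  show "0 < len triangle345 j" if "j < 3" for j using that unfolding less by (auto simp: triangle345_def)
qed (simp_all add: triangle345_def)

text \<open>A walk once round the subdivided triangle; the old vertices sit at positions 0, 3 and 7,
  the partial sums of the lengths 3, 4, 5. \<open>unit_edge j\<close> starts at
  \<open>unit_vertex j\<close>.\<close>

definition unit_vertex :: "nat \<Rightarrow> nat + nat \<times> nat" where
  "unit_vertex j = [Inl 0, Inr (0, 1), Inr (0, 2), Inl 1, Inr (1, 1), Inr (1, 2), Inr (1, 3),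
        Inl 2, Inr (2, 1), Inr (2, 2), Inr (2, 3), Inr (2, 4)] ! j"

definition unit_edge :: "nat \<Rightarrow> nat \<times> nat" where
  "unit_edge j = [(0, 0), (0, 1), (0, 2), (1, 0), (1, 1), (1, 2), (1, 3),
        (2, 0), (2, 1), (2, 2), (2, 3), (2, 4)] ! j"

lemma cycle_graph_unit_triangle345: "cycle_graph unit_triangle345 12 unit_vertex unit_edge"
proof
  have less: "{..<12} = {0, 1, 2, 3, 4, 5, 6, 7, 8, 9, 10, 11 :: nat}"
    by (rule set_eqI) (simp; presburger)
  have E: "unit_edge ` {..<12} = edges unit_triangle345" and V: "unit_vertex ` {..<12} = verts unit_triangle345"
    unfolding less edges_unit_triangle345 verts_unit_triangle345
    by (simp_all add: unit_edge_def unit_vertex_def insert_commute)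
  show "edges unit_triangle345 = unit_edge ` {..<12}" "verts unit_triangle345 = unit_vertex ` {..<12}" using E V by simp_all
  \<comment> \<open>Twelve indices are mapped onto twelve elements, so no pairwise comparison is
    needed.\<close>
  show "inj_on unit_edge {..<12}"
    by (rule eq_card_imp_inj_on) (unfold E card_unit_triangle345, simp_all)
  show "inj_on unit_vertex {..<12}"
    by (rule eq_card_imp_inj_on) (unfold V card_unit_triangle345, simp_all)
  have all: "(\<forall>j\<in>{..<12}. P j) \<longleftrightarrow>
    P 0 \<and> P 1 \<and> P 2 \<and> P 3 \<and> P 4 \<and> P 5 \<and> P 6 \<and> P 7 \<and> P 8 \<and> P 9 \<and> P 10 \<and> P 11" for P :: "nat \<Rightarrow> bool"
    unfolding less by simp
  have "\<forall>j\<in>{..<12}. tail unit_triangle345 (unit_edge j) = unit_vertex j"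
    unfolding all unit_edge_def unit_vertex_def by (simp add: unit_triangle345_def subdivide_def division_point_triangle345)
  thus "tail unit_triangle345 (unit_edge j) = unit_vertex j" if "j < 12" for j using that by simp
  have "\<forall>j\<in>{..<12}. head unit_triangle345 (unit_edge j) = unit_vertex (Suc j mod 12)"
    unfolding all unit_edge_def unit_vertex_def by (simp add: unit_triangle345_def subdivide_def division_point_triangle345)
  thus "head unit_triangle345 (unit_edge j) = unit_vertex (Suc j mod 12)" if "j < 12" for j using that by simp
  show "0 < len unit_triangle345 (unit_edge j)" if "j < 12" for j
    using that E len_unit_triangle345[of "unit_edge j"] by (metis image_eqI lessThan_iff zero_less_one)
qed simp

theorem mainTheorem5:
  fixes k :: nat
  assumes "k \<ge> 1"
  shows "eigenvalue k (L_st unit_triangle345) = eigenvalue k (L_ast unit_triangle345)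
    \<and> eigenvalue k (L_ast triangle345) \<le> eigenvalue (k + 1) (L_ast unit_triangle345)
    \<and> eigenvalue (k + 1) (L_st triangle345) \<ge> eigenvalue k (L_ast triangle345)"
proof -
  note T = cycle_graph_triangle345 and U = cycle_graph_unit_triangle345
  have totT: "cycle_graph.offset triangle345 (\<lambda>j. j) 3 = 12"
    unfolding cycle_graph.offset_def[OF T] numeral_3_eq_3 lessThan_Suc lessThan_0
    by (simp add: triangle345_def)
  have totU: "cycle_graph.offset unit_triangle345 unit_edge 12 = 12"
  proof -
    have "len unit_triangle345 (unit_edge j) = 1" if "j < 12" for j
      using that cycle_graph.edges[OF U] by (intro len_unit_triangle345) auto
    thus ?thesis by (simp add: cycle_graph.offset_def[OF U])
  qed
  define per where "per = (\<lambda>k. (2 * pi * real ((k + 1) div 2) / 12)\<^sup>2)"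
  define anti where "anti = (\<lambda>k. (pi * (2 * real (k div 2) + 1) / 12)\<^sup>2)"
  \<comment> \<open>The parity of the number of edges decides between the periodic and the
    antiperiodic list.\<close>
  have sgn: "(- 1 :: complex) ^ 12 = 1" "(- 1 :: complex) ^ 3 = - 1" by simp_all
  note per_U = cycle_graph.periodic_enumeration[OF U, unfolded totU, folded per_def]
    and per_T = cycle_graph.periodic_enumeration[OF T, unfolded totT, folded per_def]
    and anti_T = cycle_graph.antiperiodic_enumeration[OF T, unfolded totT, folded anti_def]
  have "eigenvalue_enumeration (L_st unit_triangle345) per"
    unfolding L_st_def cycle_graph.dom_st_eq[OF U] by (rule per_U[OF power_one])
  moreover have "eigenvalue_enumeration (L_ast unit_triangle345) per"
    unfolding L_ast_def cycle_graph.dom_ast_eq[OF U] by (rule per_U[OF sgn(1)])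
  moreover have "eigenvalue_enumeration (L_st triangle345) per"
    unfolding L_st_def cycle_graph.dom_st_eq[OF T] by (rule per_T[OF power_one])
  moreover have "eigenvalue_enumeration (L_ast triangle345) anti"
    unfolding L_ast_def cycle_graph.dom_ast_eq[OF T] by (rule anti_T[OF sgn(2)])
  \<comment> \<open>Eigenvalue \<open>k + 1\<close> is entry \<open>k\<close> of its list. In units
    of \<open>pi / 12\<close> the two frequencies are \<open>2 * j + 1\<close> and
    \<open>2 * j + 2\<close>, where \<open>j = (k - 1) div 2\<close>.\<close>
  moreover have "anti (k - 1) \<le> per k"
  proof -
    have "(k - 1) div 2 + 1 = (k + 1) div 2" using assms by auto
    hence "2 * real ((k - 1) div 2) + 1 \<le> 2 * real ((k + 1) div 2)" by linarith
    hence "pi * (2 * real ((k - 1) div 2) + 1) \<le> pi * (2 * real ((k + 1) div 2))"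
      by (intro mult_left_mono) auto
    thus ?thesis unfolding anti_def per_def by (intro power_mono divide_right_mono) auto
  qed
  ultimately show ?thesis by (simp add: eigenvalue_eqI)
qed

end
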